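(* The frieze sequences of the affine $\tilde A\tilde D\tilde E$ quivers have the following periodic quantities. Here a sequence $(Q_n)_{n\in\mathbb Z}$ is said to have period $r$ if $Q_{n+r}=Q_n$ for all $n\in\mathbb Z$. (1) $\tilde A_{p,q}$: $J_n:=\dfrac{x_{n+2q}+x_n}{x_{n+q}}$ has period $p$ and $\tilde J_n:=\dfrac{x_{n+2p}+x_n}{x_{n+p}}$ has period $q$. (2) $\tilde D_N$, $N\ge4$: $J_n:=\dfrac{X^1_{n+1}+X^1_{n-1}}{X^2_n}$ has period $N-2$, and $X^1_n/X^2_n$ and $X^N_n/X^{N+1}_n$ each have period $2$. (3) $\tilde E_6$: $J_n:=\dfrac{f_{n+1}+e_{n+3}g_{n+4}}{d_{n+2}}$ and $\tilde J_n:=\dfrac{f_{n-2}+e_{n-3}g_{n-4}}{d_{n-3}}$ each have period $3$, and $K_n:=\dfrac{a_{n-3}+a_{n+3}}{a_n}$ has period $2$. (4) $\tilde E_7$: $J_n:=\dfrac{e_{n+2}+a_{n+6}h_{n+4}}{g_{n+3}}$ has period $4$, $K_n:=\dfrac{a_{n+8}+a_n}{a_{n+4}}$ has period $3$, and $\tilde K_n:=a_nh_{n+7}-a_{n+4}h_{n+3}$ has period $2$. (5) $\tilde E_8$: $J_n:=\dfrac{g_{n+2}+a_{n+9}b_{n+4}}{c_{n+4}}$ has period $5$ and $K_n:=\dfrac{a_{n+20}+a_n}{a_{n+10}}$ has period $3$.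
   Context: In each case the frieze sequence is the solution, for $n\in\mathbb Z$, of the recurrences below in the field of rational functions over $\mathbb C$ in the independent initial variables (the variables with subscript $0$, or $x_0,\dots,x_{p+q-1}$ for $\tilde A_{p,q}$). The recurrences can be solved uniquely both forwards and backwards in $n$. $\tilde A_{p,q}$ ($p,q\ge1$): $x_{n+p+q}x_n=x_{n+p}x_{n+q}+1$. $\tilde D_N$ ($N\ge4$): take the graph with vertices $1,\dots,N+1$ and edges $\{1,3\},\{2,3\}$, $\{i,i+1\}$ for $3\le i\le N-2$, $\{N-1,N\},\{N-1,N+1\}$. It is bipartite; let $S$ (the sinks) be the bipartition class containing vertex $3$. Then $X^k_{n+1}X^k_n=1+\prod_{j\sim k}X^j_n$ if $k\in S$ and $X^k_{n+1}X^k_n=1+\prod_{j\sim k}X^j_{n+1}$ if $k\notin S$, where $j\sim k$ means adjacent. $\tilde E_6$: $a_{n+1}a_n=1+b_n$, $b_{n+1}b_n=1+a_{n+1}c_{n+1}$, $c_{n+1}c_n=1+b_nd_nf_n$, $d_{n+1}d_n=1+c_{n+1}e_{n+1}$, $e_{n+1}e_n=1+d_n$, $f_{n+1}f_n=1+c_{n+1}g_{n+1}$, $g_{n+1}g_n=1+f_n$. $\tilde E_7$: $a_{n+1}a_n=1+b_n$, $b_{n+1}b_n=1+a_{n+1}c_{n+1}$, $c_{n+1}c_n=1+b_nd_n$, $d_{n+1}d_n=1+c_{n+1}e_{n+1}f_{n+1}$, $e_{n+1}e_n=1+d_n$, $f_{n+1}f_n=1+d_ng_n$, $g_{n+1}g_n=1+f_{n+1}h_{n+1}$,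 $h_{n+1}h_n=1+g_n$. $\tilde E_8$: $a_{n+1}a_n=1+b_n$, $b_{n+1}b_n=1+a_{n+1}c_{n+1}$, $c_{n+1}c_n=1+b_nd_n$, $d_{n+1}d_n=1+c_{n+1}e_{n+1}$, $e_{n+1}e_n=1+d_nf_n$, $f_{n+1}f_n=1+e_{n+1}g_{n+1}h_{n+1}$, $g_{n+1}g_n=1+f_n$, $h_{n+1}h_n=1+f_ni_n$, $i_{n+1}i_n=1+h_{n+1}$. *)

theory Defs
  imports Complex_Main "HOL-Library.Poly_Mapping" "HOL-Computational_Algebra.Fraction_Field"
begin

text \<open>
  Rational functions over the complex numbers in the variables with indices 0, 1, 2, \<dots>: the
  fraction field of the polynomial ring, where a polynomial is a finitely supported map from
  monomials (finitely supported exponent vectors) to coefficients. One field serves all the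
  families; a frieze with \<open>m\<close> initial variables uses \<open>m\<close> of the variables
  and lives in the subfield of rational functions in these.
\<close>

type_synonym ratfun = "((nat \<Rightarrow>\<^sub>0 nat) \<Rightarrow>\<^sub>0 complex) fract"

definition var :: "nat \<Rightarrow> ratfun" where
  "var i = Fract (Poly_Mapping.single (Poly_Mapping.single i 1) 1) 1"

definition has_period :: "(int \<Rightarrow> 'a) \<Rightarrow> nat \<Rightarrow> bool" where
  "has_period Q r \<longleftrightarrow> (\<forall>n. Q (n + int r) = Q n)"

definition A_frieze :: "nat \<Rightarrow> nat \<Rightarrow> (int \<Rightarrow> ratfun) \<Rightarrow> bool" where
  "A_frieze p q x \<longleftrightarrow>
     (\<forall>i<p + q. x (int i) = var i) \<and>
     (\<forall>n. x (n + int p + int q) * x n = x (n + int p) * x (n + int q) + 1)"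

definition D_vertices :: "nat \<Rightarrow> nat set" where
  "D_vertices N = {1..N + 1}"

definition D_edges :: "nat \<Rightarrow> nat set set" where
  "D_edges N = {{1, 3}, {2, 3}} \<union> {{i, i + 1} |i. 3 \<le> i \<and> i \<le> N - 2}
     \<union> {{N - 1, N}, {N - 1, N + 1}}"

definition D_neighbours :: "nat \<Rightarrow> nat \<Rightarrow> nat set" where
  "D_neighbours N k = {j. {j, k} \<in> D_edges N}"

definition D_bipartition_class :: "nat \<Rightarrow> nat set \<Rightarrow> bool" where
  "D_bipartition_class N S \<longleftrightarrow>
     S \<subseteq> D_vertices N \<and> (\<forall>i j. {i, j} \<in> D_edges N \<longrightarrow> (i \<in> S \<longleftrightarrow> j \<notin> S))"

text \<open>The graph is connected, so it has only one bipartition class containing the vertex 3; see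
  the lemmas below, which also show that the description is not void.\<close>

definition D_sinks :: "nat \<Rightarrow> nat set" where
  "D_sinks N = (THE S. D_bipartition_class N S \<and> 3 \<in> S)"

lemma D_edge_cases:
  assumes "{i, j} \<in> D_edges N"
  obtains "i = 1" "j = 3" | "i = 3" "j = 1" | "i = 2" "j = 3" | "i = 3" "j = 2"
    | "3 \<le> i" "i \<le> N - 2" "j = i + 1" | "3 \<le> j" "j \<le> N - 2" "i = j + 1"
    | "i = N - 1" "j = N" | "i = N" "j = N - 1"
    | "i = N - 1" "j = N + 1" | "i = N + 1" "j = N - 1"
  using assms unfolding D_edges_def by (auto simp: doubleton_eq_iff)

lemma D_bipartition_class_iff:
  assumes "N \<ge> 4"
  shows "D_bipartition_class N S \<and> 3 \<in> S \<longleftrightarrow>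
    S = {k \<in> {3..N - 1}. odd k} \<union> (if odd N then {N, N + 1} else {})" (is "_ \<longleftrightarrow> S = ?T")
proof
  assume "S = ?T"
  moreover have "D_bipartition_class N ?T"
    unfolding D_bipartition_class_def
  proof (intro conjI allI impI)
    show "?T \<subseteq> D_vertices N"
      using assms by (auto simp: D_vertices_def)
    show "i \<in> ?T \<longleftrightarrow> j \<notin> ?T" if "{i, j} \<in> D_edges N" for i j
      using that
    proof (cases rule: D_edge_cases)
      case 5
      thus ?thesis using assms by auto
    next
      case 6
      thus ?thesis using assms by auto
    qed (use assms in \<open>simp_all, presburger+\<close>)
  qed
  moreover have "3 \<in> ?T"
    using assms by auto
  ultimately show "D_bipartition_class N S \<and> 3 \<in> S"
    by simp
next
  assume S: "D_bipartition_class N S \<and> 3 \<in> S"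
  hence sub: "S \<subseteq> D_vertices N" and "3 \<in> S"
    and bip: "\<And>i j. {i, j} \<in> D_edges N \<Longrightarrow> i \<in> S \<longleftrightarrow> j \<notin> S"
    unfolding D_bipartition_class_def by blast+
  have mid: "k \<in> S \<longleftrightarrow> odd k" if "3 \<le> k" "k \<le> N - 1" for k
    using that
  proof (induction k rule: dec_induct)
    case base
    show ?case using \<open>3 \<in> S\<close> by simp
  next
    case (step k)
    have "{k, k + 1} \<in> D_edges N"
      unfolding D_edges_def using step.hyps step.prems by (intro UnI1 UnI2 CollectI exI[of _ k]) auto
    hence "k \<in> S \<longleftrightarrow> Suc k \<notin> S"
      using bip by simp
    moreover have "k \<in> S \<longleftrightarrow> odd k"
      using step.prems by (intro step.IH) simp
    ultimately show ?case by simp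
  qed
  have "{1, 3} \<in> D_edges N" "{2, 3} \<in> D_edges N" "{N - 1, N} \<in> D_edges N"
    "{N - 1, N + 1} \<in> D_edges N"
    unfolding D_edges_def by blast+
  note edges = this[THEN bip]
  have one: "1 \<notin> S" "2 \<notin> S"
    using edges \<open>3 \<in> S\<close> by blast+
  have "N - 1 \<in> S \<longleftrightarrow> even N"
    using mid[of "N - 1"] assms by simp
  hence last: "N \<in> S \<longleftrightarrow> odd N" "N + 1 \<in> S \<longleftrightarrow> odd N"
    using edges by blast+
  show "S = ?T"
  proof (rule set_eqI)
    fix k
    consider "k \<notin> D_vertices N" | "k = 1" | "k = 2" | "3 \<le> k" "k \<le> N - 1" | "k = N" | "k = N + 1"
      unfolding D_vertices_def atLeastAtMost_iff by linarith
    thus "k \<in> S \<longleftrightarrow> k \<in> ?T"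
    proof cases
      case 1
      thus ?thesis using sub assms by (auto simp: D_vertices_def)
    next
      case 4
      thus ?thesis using mid by auto
    qed (use one last assms in auto)
  qed
qed

lemma D_sinks_eq:
  assumes "N \<ge> 4"
  shows "D_sinks N = {k \<in> {3..N - 1}. odd k} \<union> (if odd N then {N, N + 1} else {})"
  unfolding D_sinks_def D_bipartition_class_iff[OF assms] by (rule the_eq_trivial)

text \<open>The initial variable \<open>X\<^sup>k\<^sub>0\<close> is the variable with index \<open>k\<close>.\<close>

definition D_frieze :: "nat \<Rightarrow> (nat \<Rightarrow> int \<Rightarrow> ratfun) \<Rightarrow> bool" where
  "D_frieze N X \<longleftrightarrow>
     (\<forall>k\<in>D_vertices N. X k 0 = var k) \<and>
     (\<forall>n. \<forall>k\<in>D_vertices N.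
        X k (n + 1) * X k n =
          1 + (\<Prod>j\<in>D_neighbours N k. X j (if k \<in> D_sinks N then n else n + 1)))"

definition E6_frieze :: "(int \<Rightarrow> ratfun) \<Rightarrow> (int \<Rightarrow> ratfun) \<Rightarrow> (int \<Rightarrow> ratfun) \<Rightarrow> (int \<Rightarrow> ratfun) \<Rightarrow>
    (int \<Rightarrow> ratfun) \<Rightarrow> (int \<Rightarrow> ratfun) \<Rightarrow> (int \<Rightarrow> ratfun) \<Rightarrow> bool" where
  "E6_frieze a b c d e f g \<longleftrightarrow>
     a 0 = var 0 \<and> b 0 = var 1 \<and> c 0 = var 2 \<and> d 0 = var 3 \<and> e 0 = var 4 \<and> f 0 = var 5 \<and>
     g 0 = var 6 \<and>
     (\<forall>n. a (n + 1) * a n = 1 + b n \<and>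
          b (n + 1) * b n = 1 + a (n + 1) * c (n + 1) \<and>
          c (n + 1) * c n = 1 + b n * d n * f n \<and>
          d (n + 1) * d n = 1 + c (n + 1) * e (n + 1) \<and>
          e (n + 1) * e n = 1 + d n \<and>
          f (n + 1) * f n = 1 + c (n + 1) * g (n + 1) \<and>
          g (n + 1) * g n = 1 + f n)"

definition E7_frieze :: "(int \<Rightarrow> ratfun) \<Rightarrow> (int \<Rightarrow> ratfun) \<Rightarrow> (int \<Rightarrow> ratfun) \<Rightarrow> (int \<Rightarrow> ratfun) \<Rightarrow>
    (int \<Rightarrow> ratfun) \<Rightarrow> (int \<Rightarrow> ratfun) \<Rightarrow> (int \<Rightarrow> ratfun) \<Rightarrow> (int \<Rightarrow> ratfun) \<Rightarrow> bool" where
  "E7_frieze a b c d e f g h \<longleftrightarrow>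
     a 0 = var 0 \<and> b 0 = var 1 \<and> c 0 = var 2 \<and> d 0 = var 3 \<and> e 0 = var 4 \<and> f 0 = var 5 \<and>
     g 0 = var 6 \<and> h 0 = var 7 \<and>
     (\<forall>n. a (n + 1) * a n = 1 + b n \<and>
          b (n + 1) * b n = 1 + a (n + 1) * c (n + 1) \<and>
          c (n + 1) * c n = 1 + b n * d n \<and>
          d (n + 1) * d n = 1 + c (n + 1) * e (n + 1) * f (n + 1) \<and>
          e (n + 1) * e n = 1 + d n \<and>
          f (n + 1) * f n = 1 + d n * g n \<and>
          g (n + 1) * g n = 1 + f (n + 1) * h (n + 1) \<and>
          h (n + 1) * h n = 1 + g n)"

definition E8_frieze :: "(int \<Rightarrow> ratfun) \<Rightarrow> (int \<Rightarrow> ratfun) \<Rightarrow> (int \<Rightarrow> ratfun) \<Rightarrow> (int \<Rightarrow> ratfun) \<Rightarrow>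
    (int \<Rightarrow> ratfun) \<Rightarrow> (int \<Rightarrow> ratfun) \<Rightarrow> (int \<Rightarrow> ratfun) \<Rightarrow> (int \<Rightarrow> ratfun) \<Rightarrow> (int \<Rightarrow> ratfun) \<Rightarrow>
    bool" where
  "E8_frieze a b c d e f g h i \<longleftrightarrow>
     a 0 = var 0 \<and> b 0 = var 1 \<and> c 0 = var 2 \<and> d 0 = var 3 \<and> e 0 = var 4 \<and> f 0 = var 5 \<and>
     g 0 = var 6 \<and> h 0 = var 7 \<and> i 0 = var 8 \<and>
     (\<forall>n. a (n + 1) * a n = 1 + b n \<and>
          b (n + 1) * b n = 1 + a (n + 1) * c (n + 1) \<and>
          c (n + 1) * c n = 1 + b n * d n \<and>
          d (n + 1) * d n = 1 + c (n + 1) * e (n + 1) \<and>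
          e (n + 1) * e n = 1 + d n * f n \<and>
          f (n + 1) * f n = 1 + e (n + 1) * g (n + 1) * h (n + 1) \<and>
          g (n + 1) * g n = 1 + f n \<and>
          h (n + 1) * h n = 1 + f n * i n \<and>
          i (n + 1) * i n = 1 + h (n + 1))"

end

theory Submission
  imports Defs
begin

text \<open>
  The coefficient sum of a polynomial is a ring homomorphism, so the rational functions that are
  quotients of polynomials with positive coefficient sums form a semifield. It contains the initial
  variables and hence every entry of a frieze, so no entry vanishes and we may divide freely.

  For a sequence \<open>x\<close> with a relation \<open>x\<^sub>n\<^sub>+\<^sub>p\<^sub>+\<^sub>q x\<^sub>n - x\<^sub>n\<^sub>+\<^sub>p x\<^sub>n\<^sub>+\<^sub>q = 1\<close>, comparing two consecutive
  such relations shows that neighbours satisfy a three-term linear relation whose coefficient is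
  periodic. This settles type A; in type D the mesh relations turn the graph into a strip of such
  relations of width \<open>N - 2\<close>, and a coefficient carried across the strip in both of its diagonal
  directions returns shifted by \<open>N - 2\<close>.

  In type E every periodic quantity \<open>Q\<close> satisfies several exchange relations, of the form
  \<open>Q\<close> times an entry equals a sum of two products of entries, or \<open>Q\<close> equals a difference
  of two products of entries. The frieze relations are invariant under reflection of time, so such an
  expression and its mirror image both give \<open>Q\<close>, and the two differ from each other by a shift
  through the period. Each exchange relation follows from
  earlier ones after multiplication by a nonzero entry.
\<close>

section \<open>Positivity\<close>

definition coeff_sum :: "('a \<Rightarrow>\<^sub>0 'b::comm_semiring_1) \<Rightarrow> 'b" where
  "coeff_sum p = (\<Sum>k\<in>Poly_Mapping.keys p. Poly_Mapping.lookup p k)"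

lemma coeff_sum_superset:
  assumes "finite A" "Poly_Mapping.keys p \<subseteq> A"
  shows "coeff_sum p = (\<Sum>k\<in>A. Poly_Mapping.lookup p k)"
  unfolding coeff_sum_def using assms by (intro sum.mono_neutral_left) (auto simp: in_keys_iff)

lemma coeff_sum_zero [simp]: "coeff_sum 0 = 0"
  by (simp add: coeff_sum_def)

lemma coeff_sum_single [simp]: "coeff_sum (Poly_Mapping.single k v) = v"
  by (simp add: coeff_sum_def)

lemma coeff_sum_one [simp]: "coeff_sum (1 :: 'a::zero \<Rightarrow>\<^sub>0 'b::comm_semiring_1) = 1"
  by (simp flip: single_one)

lemma coeff_sum_add [simp]: "coeff_sum (p + q) = coeff_sum p + coeff_sum q"
proof -
  \<comment> \<open>The keys of \<open>p + q\<close> can shrink by cancellation, so all three sums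
    run over the union of the keys of \<open>p\<close> and \<open>q\<close>.\<close>
  have "coeff_sum r = (\<Sum>k\<in>Poly_Mapping.keys p \<union> Poly_Mapping.keys q. Poly_Mapping.lookup r k)" if "r \<in> {p, q, p + q}" for r
    using that Poly_Mapping.keys_add[of p q] by (intro coeff_sum_superset) auto
  thus ?thesis
    by (simp add: lookup_add sum.distrib)
qed

lemma update_eq_single_add:
  assumes "k \<notin> Poly_Mapping.keys p"
  shows "Poly_Mapping.update k v p = Poly_Mapping.single k v + p"
  using assms
  by (intro poly_mapping_eqI) (auto simp: lookup_update lookup_add lookup_single in_keys_iff)

text \<open>Splitting off one monomial at a time, first from \<open>p\<close> and then from
  \<open>q\<close>, leaves only products of two monomials, whose coefficients multiply.\<close>

lemma coeff_sum_mult [simp]: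
  fixes p q :: "'a::monoid_add \<Rightarrow>\<^sub>0 'b::comm_semiring_1"
  shows "coeff_sum (p * q) = coeff_sum p * coeff_sum q"
proof (induction p rule: update_induct)
  case const
  show ?case by simp
next
  case (update p k v)
  have "coeff_sum (Poly_Mapping.single k v * q) = v * coeff_sum q"
  proof (induction q rule: update_induct)
    case (update q l w)
    thus ?case
      by (simp add: update_eq_single_add mult_single algebra_simps)
  qed simp
  with update show ?case
    by (simp add: update_eq_single_add algebra_simps)
qed

section \<open>The semifield of rational functions with positive value at the all-ones point\<close>

text \<open>The witnesses \<open>r\<close> and \<open>s\<close> say that the complex values at the
  all-ones point are positive reals. This forces numerator and denominator to be nonzero.\<close>

definition positive :: "ratfun set" where
  "positive = {Fract p q |p q r s.
     coeff_sum p = complex_of_real r \<and> coeff_sum q = complex_of_real s \<and> r > 0 \<and> s > 0}"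

lemma positiveI:
  assumes "coeff_sum p = complex_of_real r" "coeff_sum q = complex_of_real s" "r > 0" "s > 0"
  shows "Fract p q \<in> positive"
  using assms unfolding positive_def by blast

lemma positiveE:
  assumes "x \<in> positive"
  obtains p q r s where "x = Fract p q" "p \<noteq> 0" "q \<noteq> 0" "r > 0" "s > 0"
    "coeff_sum p = complex_of_real r" "coeff_sum q = complex_of_real s"
proof -
  from assms obtain p q r s where *: "x = Fract p q" "r > 0" "s > 0"
    "coeff_sum p = complex_of_real r" "coeff_sum q = complex_of_real s"
    unfolding positive_def by blast
  moreover from this have "p \<noteq> 0" "q \<noteq> 0" by auto
  ultimately show thesis using that by blast
qed

lemma positive_nonzero: "x \<in> positive \<Longrightarrow> x \<noteq> 0"
  by (elim positiveE) (simp add: Zero_fract_def eq_fract)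

lemma positive_var [simp]: "var i \<in> positive"
  unfolding var_def by (rule positiveI[of _ 1 _ 1]) simp_all

lemma positive_one [simp]: "1 \<in> positive"
  unfolding One_fract_def by (rule positiveI[of _ 1 _ 1]) simp_all

lemma positive_add [simp]:
  assumes "x \<in> positive" "y \<in> positive"
  shows "x + y \<in> positive"
proof -
  obtain p q r s where x: "x = Fract p q" "q \<noteq> 0" "r > 0" "s > 0"
    "coeff_sum p = complex_of_real r" "coeff_sum q = complex_of_real s"
    using assms(1) by (rule positiveE)
  obtain p' q' r' s' where y: "y = Fract p' q'" "q' \<noteq> 0" "r' > 0" "s' > 0"
    "coeff_sum p' = complex_of_real r'" "coeff_sum q' = complex_of_real s'"
    using assms(2) by (rule positiveE)
  have "Fract (p * q' + p' * q) (q * q') \<in> positive"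
    using x y by (intro positiveI[of _ "r * s' + r' * s" _ "s * s'"]) (simp_all add: add_pos_pos)
  thus ?thesis using x y by simp
qed

lemma positive_mult [simp]:
  assumes "x \<in> positive" "y \<in> positive"
  shows "x * y \<in> positive"
proof -
  obtain p q r s where x: "x = Fract p q" "r > 0" "s > 0"
    "coeff_sum p = complex_of_real r" "coeff_sum q = complex_of_real s"
    using assms(1) by (rule positiveE)
  obtain p' q' r' s' where y: "y = Fract p' q'" "r' > 0" "s' > 0"
    "coeff_sum p' = complex_of_real r'" "coeff_sum q' = complex_of_real s'"
    using assms(2) by (rule positiveE)
  have "Fract (p * p') (q * q') \<in> positive"
    using x y by (intro positiveI[of _ "r * r'" _ "s * s'"]) simp_all
  thus ?thesis using x y by simp
qed

lemma positive_inverse: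
  assumes "x \<in> positive"
  shows "inverse x \<in> positive"
proof -
  obtain p q r s where x: "x = Fract p q" "r > 0" "s > 0"
    "coeff_sum p = complex_of_real r" "coeff_sum q = complex_of_real s"
    using assms by (rule positiveE)
  thus ?thesis by (auto intro: positiveI[of _ s _ r])
qed

lemma positive_prod [simp]: "(\<And>i. i \<in> A \<Longrightarrow> F i \<in> positive) \<Longrightarrow> prod F A \<in> positive"
  by (induction A rule: infinite_finite_induct) simp_all

text \<open>A frieze relation gives the product of two entries of one sequence, so positivity of the
  product carries positivity both forwards and backwards in time.\<close>

lemma positive_iff_of_mult:
  assumes "x * y \<in> positive"
  shows "x \<in> positive \<longleftrightarrow> y \<in> positive"
proof -
  have "v \<in> positive" if "u * v \<in> positive" "u \<in> positive" for u v :: ratfun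
  proof -
    have "v = inverse u * (u * v)"
      using positive_nonzero[OF that(2)] by (simp add: field_simps)
    thus ?thesis using that by (metis positive_inverse positive_mult)
  qed
  from this[of x y] this[of y x] assms show ?thesis by (auto simp: mult.commute)
qed

section \<open>Positivity of the frieze entries\<close>

text \<open>\<open>E\<close> stands for the sequences updated first, from the old values of the
  others, and \<open>L\<close> for those updated second, from the new values. Going backwards,
  \<open>L\<close> is recovered before \<open>E\<close>; the equivalences serve both
  directions.\<close>

lemma bipartite_int_induct [case_names early late stepE stepL]:
  fixes n :: int
  assumes "E 0" "L 0"
    and "\<And>n. L n \<Longrightarrow> E (n + 1) \<longleftrightarrow> E n"
    and "\<And>n. E (n + 1) \<Longrightarrow> L (n + 1) \<longleftrightarrow> L n"
  shows "E n \<and> L n"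
proof (induction n rule: int_induct[of _ 0])
  case (step1 n)
  thus ?case using assms(3,4)[of n] by blast
next
  case (step2 n)
  thus ?case using assms(3,4)[of "n - 1"] by auto
qed (use assms in blast)

lemma E6_frieze_positive:
  assumes "E6_frieze a b c d e f g"
  shows "{a n, c n, e n, g n} \<subseteq> positive \<and> {b n, d n, f n} \<subseteq> positive"
proof (induction n rule: bipartite_int_induct)
  case (stepE n)
  have "u (n + 1) \<in> positive \<longleftrightarrow> u n \<in> positive" if "u \<in> {a, c, e, g}" for u
    using assms stepE that unfolding E6_frieze_def by (intro positive_iff_of_mult) auto
  thus ?case by simp
next
  case (stepL n)
  have "u (n + 1) \<in> positive \<longleftrightarrow> u n \<in> positive" if "u \<in> {b, d, f}" for u
    using assms stepL that unfolding E6_frieze_def by (intro positive_iff_of_mult) auto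
  thus ?case by simp
qed (use assms in \<open>simp_all add: E6_frieze_def\<close>)

lemma E7_frieze_positive:
  assumes "E7_frieze a b c d e f g h"
  shows "{a n, c n, e n, f n, h n} \<subseteq> positive \<and> {b n, d n, g n} \<subseteq> positive"
proof (induction n rule: bipartite_int_induct)
  case (stepE n)
  have "u (n + 1) \<in> positive \<longleftrightarrow> u n \<in> positive" if "u \<in> {a, c, e, f, h}" for u
    using assms stepE that unfolding E7_frieze_def by (intro positive_iff_of_mult) auto
  thus ?case by simp
next
  case (stepL n)
  have "u (n + 1) \<in> positive \<longleftrightarrow> u n \<in> positive" if "u \<in> {b, d, g}" for u
    using assms stepL that unfolding E7_frieze_def by (intro positive_iff_of_mult) auto
  thus ?case by simp
qed (use assms in \<open>simp_all add: E7_frieze_def\<close>)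

lemma E8_frieze_positive:
  assumes "E8_frieze a b c d e f g h i"
  shows "{a n, c n, e n, g n, h n} \<subseteq> positive \<and> {b n, d n, f n, i n} \<subseteq> positive"
proof (induction n rule: bipartite_int_induct)
  case (stepE n)
  have "u (n + 1) \<in> positive \<longleftrightarrow> u n \<in> positive" if "u \<in> {a, c, e, g, h}" for u
    using assms stepE that unfolding E8_frieze_def by (intro positive_iff_of_mult) auto
  thus ?case by simp
next
  case (stepL n)
  have "u (n + 1) \<in> positive \<longleftrightarrow> u n \<in> positive" if "u \<in> {b, d, f, i}" for u
    using assms stepL that unfolding E8_frieze_def by (intro positive_iff_of_mult) auto
  thus ?case by simp
qed (use assms in \<open>simp_all add: E8_frieze_def\<close>)

text \<open>The recurrence has order \<open>p + q\<close>, so the induction carries a window of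
  \<open>p + q\<close> successive entries and slides it by one place in either direction.\<close>

lemma A_frieze_positive:
  assumes "A_frieze p q x" "p \<ge> 1" "q \<ge> 1"
  shows "x n \<in> positive"
proof -
  note rec = assms(1)[unfolded A_frieze_def, THEN conjunct2, rule_format]
  have "\<forall>j\<in>{0..<int (p + q)}. x (n + j) \<in> positive"
  proof (induction n rule: int_induct[of _ 0])
    case base
    have "x (int j) \<in> positive" if "j < p + q" for j
      using assms(1) that by (simp add: A_frieze_def)
    thus ?case by (metis add.left_neutral atLeastLessThan_iff of_nat_less_iff zero_le_imp_eq_int)
  next
    case (step1 m)
    \<comment> \<open>As \<open>p\<close> and \<open>q\<close> are at least 1, both are below
      \<open>p + q\<close>, and the right side of the relation at \<open>m\<close> involves only
      entries of the window.\<close>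
    have "x (m + int p + int q) \<in> positive"
      using rec[of m] step1 assms(2,3) by (subst positive_iff_of_mult[of _ "x m"]) force+
    moreover have "m + 1 + j = m + int p + int q \<or> j + 1 \<in> {0..<int (p + q)}"
      if "j \<in> {0..<int (p + q)}" for j
      using that by auto
    ultimately show ?case using step1(2) by (metis add.assoc add.commute)
  next
    case (step2 m)
    have "x (m - 1) \<in> positive"
      using rec[of "m - 1"] step2(2)[rule_format, of "int p - 1"]
        step2(2)[rule_format, of "int q - 1"] step2(2)[rule_format, of "int p + int q - 1"] assms(2,3)
      by (subst positive_iff_of_mult[of _ "x (m - 1 + int p + int q)"])
        (simp_all add: algebra_simps)
    moreover have "j = 0 \<or> j - 1 \<in> {0..<int (p + q)}" if "j \<in> {0..<int (p + q)}" for j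
      using that by auto
    moreover have "m - 1 + j = m + (j - 1)" for j by simp
    ultimately show ?case using step2(2) by (metis add.right_neutral)
  qed
  from this[rule_format, of 0] show ?thesis using assms(2) by simp
qed

section \<open>Types A and D\<close>

text \<open>The relations at \<open>n\<close> and \<open>n + q\<close> write 1 as two determinants
  that share the entries \<open>x (n + q)\<close> and \<open>x (n + p + q)\<close>. Equating them
  and collecting these two factors gives the claim.\<close>

lemma A_recurrence_period:
  fixes x :: "int \<Rightarrow> 'a::field" and p q n :: int
  assumes "\<And>n. x n \<noteq> 0" and rec: "\<And>n. x (n + p + q) * x n = x (n + p) * x (n + q) + 1"
  shows "(x (n + p + 2 * q) + x (n + p)) / x (n + p + q) = (x (n + 2 * q) + x n) / x (n + q)"
proof -
  have "n + q + p + q = n + p + 2 * q" "n + q + p = n + p + q" "n + q + q = n + 2 * q"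
    by simp_all
  hence "(x (n + p + 2 * q) + x (n + p)) * x (n + q) = (x (n + 2 * q) + x n) * x (n + p + q)"
    using rec[of n] rec[of "n + q"] by algebra
  thus ?thesis using assms(1) by (simp add: frac_eq_eq)
qed

lemma A_frieze_periods:
  assumes "A_frieze p q x" "p \<ge> 1" "q \<ge> 1"
  shows "has_period (\<lambda>n. (x (n + 2 * int q) + x n) / x (n + int q)) p"
    and "has_period (\<lambda>n. (x (n + 2 * int p) + x n) / x (n + int p)) q"
proof -
  have nz: "x n \<noteq> 0" for n
    using A_frieze_positive[OF assms] by (rule positive_nonzero)
  have rec: "x (n + int p + int q) * x n = x (n + int p) * x (n + int q) + 1" for n
    using assms(1) unfolding A_frieze_def by blast
  show "has_period (\<lambda>n. (x (n + 2 * int q) + x n) / x (n + int q)) p"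
    unfolding has_period_def using A_recurrence_period[of x "int p" "int q", OF nz rec] by simp
  \<comment> \<open>The recurrence is symmetric in \<open>p\<close> and \<open>q\<close>, so the
    second period is the first with the roles exchanged.\<close>
  have "x (n + int q + int p) * x n = x (n + int q) * x (n + int p) + 1" for n
    using rec[of n] by (simp add: add.assoc add.commute[of "int q"] mult.commute)
  thus "has_period (\<lambda>n. (x (n + 2 * int p) + x n) / x (n + int p)) q"
    unfolding has_period_def using A_recurrence_period[of x "int q" "int p", OF nz] by simp
qed

section \<open>Type D: linear relations in a strip\<close>

text \<open>At an end of the strip the column is a product of two leaves \<open>u\<close> and
  \<open>v\<close>; \<open>y\<close> and \<open>z\<close> lie in the next column and
  \<open>w\<close> in the one after. After clearing denominators and multiplying by
  \<open>u1\<close>, both sides become \<open>y * (y + z + 2)\<close>.\<close>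

lemma strip_end:
  fixes u0 u1 u2 v0 v1 w y z :: "'a::field"
  assumes "u0 * u1 = 1 + y" "v0 * v1 = 1 + y" "u1 * u2 = 1 + z" "w * (u1 * v1) = y * z - 1"
    and "u1 \<noteq> 0" "v1 \<noteq> 0" "y \<noteq> 0"
  shows "(w + u0 * v0) / y = (u2 + u0) / v1"
proof -
  have "u1 * ((w + u0 * v0) * v1) = u1 * ((u2 + u0) * y)"
    using assms(1-4) by algebra
  thus ?thesis using assms(5-7) by (simp add: frac_eq_eq)
qed

text \<open>\<open>C\<close> keeps its index from column to column, \<open>R\<close> moves it by
  one, and each end of the strip turns one into the other: \<open>C 3 i = C (N - 1) i = R (N - 1) (i
  + 1) = R 3 (i + N - 3) = C 3 (i + N - 2)\<close>.\<close>

lemma strip_period: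
  fixes Z :: "nat \<Rightarrow> int \<Rightarrow> 'a::field" and u v s t :: "int \<Rightarrow> 'a" and N :: nat
  assumes N: "N \<ge> 4"
    and nz: "\<And>k i. 2 \<le> k \<Longrightarrow> k \<le> N \<Longrightarrow> Z k i \<noteq> 0"
    and mesh: "\<And>k i. 3 \<le> k \<Longrightarrow> k < N \<Longrightarrow> Z k i * Z k (i + 1) = 1 + Z (k - 1) (i + 1) * Z (k + 1) i"
    and bottom: "\<And>i. Z 2 i = u i * v i" "\<And>i. u i * u (i + 1) = 1 + Z 3 i"
      "\<And>i. v i * v (i + 1) = 1 + Z 3 i"
    and top: "\<And>i. Z N i = s i * t i" "\<And>i. s i * s (i + 1) = 1 + Z (N - 1) (i + 1)"
      "\<And>i. t i * t (i + 1) = 1 + Z (N - 1) (i + 1)"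
  shows "(u (i + int (N - 2) + 1) + u (i + int (N - 2) - 1)) / v (i + int (N - 2)) =
         (u (i + 1) + u (i - 1)) / v i"
proof -
  \<comment> \<open>Coefficients along the two diagonals through \<open>Z k i\<close>:
    \<open>R\<close> takes the neighbours with the same \<open>i\<close>, \<open>C\<close> those
    with the same \<open>k + i\<close>.\<close>
  define R where "R k i = (Z (k + 1) i + Z (k - 1) i) / Z k i" for k i
  define C where "C k i = (Z (k + 1) (i - 1) + Z (k - 1) (i + 1)) / Z k i" for k i
  have nz_ends: "u i \<noteq> 0" "v i \<noteq> 0" "s i \<noteq> 0" "t i \<noteq> 0" for i
    using nz[of 2 i] nz[of N i] N by (auto simp: bottom(1) top(1))
  have R: "R (3 + m) i = R 3 (i + int m)" if "3 + m < N" for m i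
    using that
  proof (induction m arbitrary: i)
    case (Suc m)
    \<comment> \<open>Two adjacent columns have equal mesh determinants; for \<open>C\<close> the
      comparison takes the upper column one index earlier.\<close>
    have "(Z (5 + m) i + Z (3 + m) i) * Z (3 + m) (i + 1) =
          (Z (4 + m) (i + 1) + Z (2 + m) (i + 1)) * Z (4 + m) i"
      using mesh[of "4 + m" i] mesh[of "3 + m" i] Suc.prems by (simp add: algebra_simps)
    hence "R (4 + m) i = R (3 + m) (i + 1)"
      using nz[of "3 + m" "i + 1"] nz[of "4 + m" i] Suc.prems
      unfolding R_def by (subst frac_eq_eq) (simp_all add: numeral_eq_Suc)
    thus ?case using Suc.IH[of "i + 1"] Suc.prems by (simp add: algebra_simps)
  qed simp
  have C: "C (3 + m) i = C 3 i" if "3 + m < N" for m i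
    using that
  proof (induction m)
    case (Suc m)
    have "(Z (4 + m) (i - 1) + Z (2 + m) (i + 1)) * Z (4 + m) i =
          (Z (5 + m) (i - 1) + Z (3 + m) (i + 1)) * Z (3 + m) i"
      using mesh[of "4 + m" "i - 1"] mesh[of "3 + m" i] Suc.prems by (simp add: algebra_simps)
    hence "C (3 + m) i = C (4 + m) i"
      using nz[of "3 + m" i] nz[of "4 + m" i] Suc.prems
      unfolding C_def by (subst frac_eq_eq) (simp_all add: numeral_eq_Suc)
    thus ?case using Suc by simp
  qed simp
  have bottom_mesh: "Z 4 i * (u (i + 1) * v (i + 1)) = Z 3 i * Z 3 (i + 1) - 1" for i
    using mesh[of 3 i] N bottom(1)[of "i + 1"] by (simp add: mult.commute)
  have R3: "R 3 i = (u (i + 2) + u i) / v (i + 1)" for i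
    using strip_end[of "u i" "u (i + 1)" "Z 3 i" "v i" "v (i + 1)" "u (i + 2)" "Z 3 (i + 1)" "Z 4 i"]
      bottom(2)[of "i + 1"] bottom_mesh[of i] nz[of 3 i] N
    by (simp add: R_def bottom nz_ends add.commute[of 2 i])
  \<comment> \<open>The end relation is applied with time reversed; comparison with
    \<open>R3\<close> shows \<open>R 3 i = C 3 (i + 1)\<close>.\<close>
  have C3: "C 3 i = (u (i - 1) + u (i + 1)) / v i" for i
    using strip_end[of "u (i + 1)" "u i" "Z 3 i" "v (i + 1)" "v i" "u (i - 1)" "Z 3 (i - 1)" "Z 4 (i - 1)"]
      bottom(2,3)[of i] bottom(2)[of "i - 1"] bottom_mesh[of "i - 1"] nz[of 3 i] N
    by (simp add: C_def bottom(1) nz_ends mult.commute)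
  have top_mesh: "Z (N - 2) (i + 1) * (s i * t i) = Z (N - 1) i * Z (N - 1) (i + 1) - 1" for i
    using mesh[of "N - 1" i] N top(1)[of i] by (simp add: numeral_eq_Suc)
  have Rtop: "R (N - 1) i = (s (i - 2) + s i) / t (i - 1)" for i
    using strip_end[of "s i" "s (i - 1)" "Z (N - 1) i" "t i" "t (i - 1)" "s (i - 2)" "Z (N - 1) (i - 1)" "Z (N - 2) i"]
      top(2,3)[of "i - 1"] top(2)[of "i - 2"] top_mesh[of "i - 1"] nz[of "N - 1" i] N
    by (simp add: R_def top(1) nz_ends mult.commute add.commute numeral_eq_Suc)
  have Ctop: "C (N - 1) i = (s (i + 1) + s (i - 1)) / t i" for i
    using strip_end[of "s (i - 1)" "s i" "Z (N - 1) i" "t (i - 1)" "t i" "s (i + 1)" "Z (N - 1) (i + 1)" "Z (N - 2) (i + 1)"]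
      top(2,3)[of "i - 1"] top(2)[of i] top_mesh[of i] nz[of "N - 1" i] N
    by (simp add: C_def top(1) nz_ends add.commute numeral_eq_Suc)
  have "R 3 (i + int (N - 3)) = C 3 i"
  proof -
    have "R 3 (i + int (N - 3)) = R (N - 1) (i + 1)"
      using R[of "N - 4" "i + 1"] N by (simp add: of_nat_diff algebra_simps)
    also have "\<dots> = C (N - 1) i"
      unfolding Rtop Ctop by (simp add: add.commute)
    also have "\<dots> = C 3 i"
      using C[of "N - 4" i] N by simp
    finally show ?thesis .
  qed
  thus ?thesis
    using N by (simp add: R3 C3 of_nat_diff algebra_simps)
qed

section \<open>Type D: ratios of leaves and the graph as a strip\<close>

text \<open>Equal products mean that each step inverts \<open>u / v\<close>, so two steps restore
  it.\<close>

lemma cross_ratio_period: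
  fixes u v :: "int \<Rightarrow> 'a::field"
  assumes "\<And>n. u n \<noteq> 0" "\<And>n. v n \<noteq> 0" "\<And>n. u n * u (n + 1) = v n * v (n + 1)"
  shows "u (n + 2) / v (n + 2) = u n / v n"
proof -
  have "u (n + 1) * (u (n + 2) * v n) = u (n + 1) * (u n * v (n + 2))"
    using assms(3)[of n] assms(3)[of "n + 1", unfolded add.assoc, simplified] by algebra
  thus ?thesis using assms(1,2) by (simp add: frac_eq_eq)
qed

text \<open>The vertices of the graph in columns 2 to \<open>N\<close>: the two leaves at either end form one column.\<close>

definition D_column :: "nat \<Rightarrow> nat \<Rightarrow> nat set" where
  "D_column N k = (if k = 2 then {1, 2} else if k = N then {N, N + 1} else {k})"

lemma D_neighbours_inner:
  assumes "3 \<le> k" "k < N"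
  shows "D_neighbours N k = D_column N (k - 1) \<union> D_column N (k + 1)"
proof -
  obtain m where N: "N = Suc (Suc (Suc (Suc m)))"
    using assms by (intro that[of "N - 4"]) simp
  \<comment> \<open>For \<open>N = 4\<close> the single inner vertex touches both pairs of leaves;
    otherwise the two ends and the middle are separate cases.\<close>
  consider "k = 3" "m = 0" | "k = 3" "m > 0" | "k > 3" "k = N - 1" | "k > 3" "k < N - 1"
    using assms N by linarith
  thus ?thesis
    unfolding D_neighbours_def D_edges_def D_column_def
    using assms unfolding N by cases (auto simp: doubleton_eq_iff)
qed

lemma D_neighbours_leaf:
  assumes "N \<ge> 4"
  shows "D_neighbours N 1 = {3}" "D_neighbours N 2 = {3}"
    "D_neighbours N N = {N - 1}" "D_neighbours N (N + 1) = {N - 1}"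
  unfolding D_neighbours_def D_edges_def using assms by (auto simp: doubleton_eq_iff)

lemma D_neighbours_bipartite:
  assumes "N \<ge> 4" "j \<in> D_neighbours N k"
  shows "j \<in> D_vertices N" "j \<in> D_sinks N \<longleftrightarrow> k \<notin> D_sinks N"
proof -
  have edge: "{j, k} \<in> D_edges N"
    using assms(2) by (simp add: D_neighbours_def)
  thus "j \<in> D_vertices N"
    using assms(1) by (elim D_edge_cases) (auto simp: D_vertices_def)
  have "D_bipartition_class N (D_sinks N)"
    using D_bipartition_class_iff[OF assms(1), of "D_sinks N"] D_sinks_eq[OF assms(1)] by blast
  thus "j \<in> D_sinks N \<longleftrightarrow> k \<notin> D_sinks N"
    using edge unfolding D_bipartition_class_def by blast
qed

text \<open>Sinks are updated first and all neighbours of a vertex lie in the other class, so the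
  two-class induction applies.\<close>

lemma D_frieze_positive:
  assumes "D_frieze N X" "N \<ge> 4" "k \<in> D_vertices N"
  shows "X k n \<in> positive"
proof -
  note bip = D_neighbours_bipartite[OF assms(2)]
  have "(\<forall>k\<in>D_vertices N \<inter> D_sinks N. X k n \<in> positive) \<and>
        (\<forall>k\<in>D_vertices N - D_sinks N. X k n \<in> positive)"
  proof (induction n rule: bipartite_int_induct)
    case (stepE n)
    have "X k (n + 1) \<in> positive \<longleftrightarrow> X k n \<in> positive" if "k \<in> D_vertices N \<inter> D_sinks N" for k
    proof (rule positive_iff_of_mult)
      have "X k (n + 1) * X k n = 1 + (\<Prod>j\<in>D_neighbours N k. X j n)"
        using assms(1) that by (simp add: D_frieze_def)
      also have "\<dots> \<in> positive"
        using stepE bip that by (intro positive_add positive_prod positive_one) auto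
      finally show "X k (n + 1) * X k n \<in> positive" .
    qed
    thus ?case by blast
  next
    case (stepL n)
    have "X k (n + 1) \<in> positive \<longleftrightarrow> X k n \<in> positive" if "k \<in> D_vertices N - D_sinks N" for k
    proof (rule positive_iff_of_mult)
      have "X k (n + 1) * X k n = 1 + (\<Prod>j\<in>D_neighbours N k. X j (n + 1))"
        using assms(1) that by (simp add: D_frieze_def)
      also have "\<dots> \<in> positive"
        using stepL bip that by (intro positive_add positive_prod positive_one) auto
      finally show "X k (n + 1) * X k n \<in> positive" .
    qed
    thus ?case by blast
  qed (use assms(1) in \<open>auto simp: D_frieze_def\<close>)
  thus ?thesis using assms(3) by blast
qed

lemma D_frieze_periods:
  assumes "D_frieze N X" "N \<ge> 4"
  shows "has_period (\<lambda>n. (X 1 (n + 1) + X 1 (n - 1)) / X 2 n) (N - 2)"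
    and "has_period (\<lambda>n. X 1 n / X 2 n) 2"
    and "has_period (\<lambda>n. X N n / X (N + 1) n) 2"
proof -
  have rec: "X k n * X k (n + 1) = 1 + (\<Prod>j\<in>D_neighbours N k. X j (if k \<in> D_sinks N then n else n + 1))"
    if "k \<in> D_vertices N" for k n
    using assms(1) that unfolding D_frieze_def by (simp add: mult.commute)
  have nz: "X k n \<noteq> 0" if "k \<in> D_vertices N" for k n
    using D_frieze_positive[OF assms that] by (rule positive_nonzero)
  \<comment> \<open>The sinks follow parity up to \<open>N\<close>; the leaf \<open>N + 1\<close>
    breaks the pattern, being in the class of \<open>N\<close>.\<close>
  have sink: "k \<in> D_sinks N \<longleftrightarrow> odd k" if "3 \<le> k" "k \<le> N" for k
    using that assms(2) by (cases "k = N") (auto simp: D_sinks_eq)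
  have sink': "N + 1 \<in> D_sinks N \<longleftrightarrow> odd N" "1 \<notin> D_sinks N" "2 \<notin> D_sinks N"
    using assms(2) by (auto simp: D_sinks_eq)
  have V: "1 \<in> D_vertices N" "2 \<in> D_vertices N" "N \<in> D_vertices N" "N + 1 \<in> D_vertices N"
    using assms(2) by (auto simp: D_vertices_def)
  \<comment> \<open>The offset \<open>(k - 1) div 2\<close> straightens the zigzag between the
    classes: in the relation of column \<open>k\<close>, column \<open>k - 1\<close> always enters
    at \<open>i + 1\<close> and column \<open>k + 1\<close> at \<open>i\<close>. It is 0 for the
    leaves 1 and 2, so the strip period concerns them unshifted.\<close>
  define Z where "Z k i = (\<Prod>j\<in>D_column N k. X j (i + int ((k - 1) div 2)))" for k i
  have column: "D_column N k \<subseteq> D_vertices N" "finite (D_column N k)" if "2 \<le> k" "k \<le> N" for k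
    using that by (auto simp: D_column_def D_vertices_def)
  have bottom: "X k i * X k (i + 1) = 1 + Z 3 i" if "k \<in> {1, 2}" for k i
    using rec[of k i] that V assms(2) D_neighbours_leaf[OF assms(2)] sink'
    by (auto simp: Z_def D_column_def)
  have top: "X k (i + int ((N - 1) div 2)) * X k (i + 1 + int ((N - 1) div 2)) = 1 + Z (N - 1) (i + 1)"
    if "k \<in> {N, N + 1}" for k i
  proof -
    have "k \<in> D_sinks N \<longleftrightarrow> odd N" "D_neighbours N k = {N - 1}"
      using that sink[of N] sink' assms(2) D_neighbours_leaf[OF assms(2)] by auto
    moreover have "(N - 1) div 2 + (if odd N then 0 else 1) = 1 + (N - 1 - 1) div 2"
      using assms(2) by presburger
    hence "i + int ((N - 1) div 2) + (if odd N then 0 else 1) = i + 1 + int ((N - 1 - 1) div 2)"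
      by (simp split: if_splits)
    ultimately show ?thesis
      using rec[of k "i + int ((N - 1) div 2)"] that V assms(2)
      by (auto simp: Z_def D_column_def add_ac)
  qed
  have mesh: "Z k i * Z k (i + 1) = 1 + Z (k - 1) (i + 1) * Z (k + 1) i" if "3 \<le> k" "k < N" for k i
  proof -
    define n where "n = i + int ((k - 1) div 2)"
    define m where "m = (if odd k then n else n + 1)"
    have "Z k i * Z k (i + 1) = X k n * X k (n + 1)"
      using that by (simp add: Z_def D_column_def n_def add_ac)
    also have "\<dots> = 1 + (\<Prod>j\<in>D_column N (k - 1) \<union> D_column N (k + 1). X j m)"
      using rec[of k n] that sink[of k] D_neighbours_inner[OF that]
      by (simp add: m_def D_vertices_def)
    also have "\<dots> = 1 + (\<Prod>j\<in>D_column N (k - 1). X j m) * (\<Prod>j\<in>D_column N (k + 1). X j m)"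
      using that column[of "k - 1"] column[of "k + 1"]
      by (subst prod.union_disjoint) (auto simp: D_column_def)
    also have "m = i + 1 + int ((k - 1 - 1) div 2)"
    proof -
      have "(k - 1) div 2 + (if odd k then 0 else 1) = 1 + (k - 1 - 1) div 2"
        using that by presburger
      thus ?thesis by (simp add: m_def n_def split: if_splits)
    qed
    also have "(\<Prod>j\<in>D_column N (k + 1). X j (i + 1 + int ((k - 1 - 1) div 2))) = Z (k + 1) i"
    proof -
      have "i + 1 + int ((k - 1 - 1) div 2) = i + int ((k + 1 - 1) div 2)"
        using that by simp
      thus ?thesis unfolding Z_def by (simp only:)
    qed
    finally show ?thesis by (simp add: Z_def)
  qed
  have "(X 1 (i + int (N - 2) + 1) + X 1 (i + int (N - 2) - 1)) / X 2 (i + int (N - 2)) =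
        (X 1 (i + 1) + X 1 (i - 1)) / X 2 i" for i
  proof (rule strip_period[OF assms(2), of Z _ _ "\<lambda>i. X N (i + int ((N - 1) div 2))"
        "\<lambda>i. X (N + 1) (i + int ((N - 1) div 2))"])
    show "Z k i \<noteq> 0" if "2 \<le> k" "k \<le> N" for k i
      using column[OF that] nz by (auto simp: Z_def)
    show "Z 2 i = X 1 i * X 2 i" for i
      by (simp add: Z_def D_column_def)
    show "Z N i = X N (i + int ((N - 1) div 2)) * X (N + 1) (i + int ((N - 1) div 2))" for i
      using assms(2) by (simp add: Z_def D_column_def)
  qed (use mesh bottom top in auto)
  thus "has_period (\<lambda>n. (X 1 (n + 1) + X 1 (n - 1)) / X 2 n) (N - 2)"
    by (simp add: has_period_def)
  show "has_period (\<lambda>n. X 1 n / X 2 n) 2"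
    unfolding has_period_def
    using cross_ratio_period[of "X 1" "X 2"] nz[OF V(1)] nz[OF V(2)] bottom by simp
  \<comment> \<open>Evaluation at \<open>n - (N - 1) div 2\<close> undoes the offset of column
    \<open>N\<close>.\<close>
  have "X N n * X N (n + 1) = X (N + 1) n * X (N + 1) (n + 1)" for n
    using top[of N "n - int ((N - 1) div 2)"] top[of "N + 1" "n - int ((N - 1) div 2)"]
    by (simp add: algebra_simps)
  thus "has_period (\<lambda>n. X N n / X (N + 1) n) 2"
    unfolding has_period_def
    using cross_ratio_period[of "X N" "X (N + 1)"] nz[OF V(3)] nz[OF V(4)] by simp
qed

section \<open>Type E\<close>

text \<open>
  Time translates of a frieze are friezes, so the identities are stated near index 0. In the
  reflection of time, the sequences that are updated last in each step move by one more step. Along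
  an arm of the graph, the entries are continuants of the sequence at the end of the arm, which
  gives the arm relations below.
\<close>

locale E6_mesh =
  fixes a b c d e f g :: "int \<Rightarrow> 'a::field"
  assumes nonzero [simp]: "a n \<noteq> 0" "b n \<noteq> 0" "c n \<noteq> 0" "d n \<noteq> 0" "e n \<noteq> 0" "f n \<noteq> 0" "g n \<noteq> 0"
    and mesh_a: "a n * a (n + 1) = 1 + b n"
    and mesh_b: "b n * b (n + 1) = 1 + a (n + 1) * c (n + 1)"
    and mesh_c: "c n * c (n + 1) = 1 + b n * d n * f n"
    and mesh_d: "d n * d (n + 1) = 1 + c (n + 1) * e (n + 1)"
    and mesh_e: "e n * e (n + 1) = 1 + d n"
    and mesh_f: "f n * f (n + 1) = 1 + c (n + 1) * g (n + 1)"
    and mesh_g: "g n * g (n + 1) = 1 + f n"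
begin

lemmas mesh = mesh_a mesh_b mesh_c mesh_d mesh_e mesh_f mesh_g

text \<open>The graph has three equal arms at \<open>c\<close>. As the locale asks for no initial
  values, permuting the arms, translating time and reflecting it all give instances, to which every
  identity transfers.\<close>

lemma swap_ae: "E6_mesh e d c b a f g"
  by unfold_locales (simp_all only: nonzero mesh mult_ac not_False_eq_True)

lemma swap_eg: "E6_mesh a b c f g d e"
  by unfold_locales (simp_all only: nonzero mesh mult_ac not_False_eq_True)

lemma shift:
  "E6_mesh (\<lambda>n. a (n + k)) (\<lambda>n. b (n + k)) (\<lambda>n. c (n + k)) (\<lambda>n. d (n + k)) (\<lambda>n. e (n + k))
     (\<lambda>n. f (n + k)) (\<lambda>n. g (n + k))"
proof -
  have "n + 1 + k = n + k + 1" for n by simp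
  thus ?thesis by unfold_locales (simp_all only: nonzero mesh not_False_eq_True)
qed

lemma mesh_rev:
  "a n * a (n - 1) = 1 + b (n - 1)" "b n * b (n - 1) = 1 + a n * c n"
  "c n * c (n - 1) = 1 + b (n - 1) * d (n - 1) * f (n - 1)" "d n * d (n - 1) = 1 + c n * e n"
  "e n * e (n - 1) = 1 + d (n - 1)" "f n * f (n - 1) = 1 + c n * g n"
  "g n * g (n - 1) = 1 + f (n - 1)"
  using mesh[of "n - 1"] by (simp_all add: mult_ac)

lemma mirror:
  "E6_mesh (\<lambda>n. a (- n)) (\<lambda>n. b (- n - 1)) (\<lambda>n. c (- n)) (\<lambda>n. d (- n - 1)) (\<lambda>n. e (- n))
     (\<lambda>n. f (- n - 1)) (\<lambda>n. g (- n))"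
proof -
  have "- (n + 1) = - n - 1" for n :: int by simp
  thus ?thesis by unfold_locales (simp_all only: nonzero mesh_rev not_False_eq_True)
qed

lemma arm2: "a 0 * b 1 = c 1 + a 2"
proof -
  have "a 1 * (a 0 * b 1) = a 1 * (c 1 + a 2)"
    using mesh_a[of 0, simplified] mesh_b[of 0, simplified] mesh_a[of 1, simplified] by algebra
  thus ?thesis by simp
qed

lemma arm2': "a 2 * b 0 = c 1 + a 0"
  using E6_mesh.arm2[OF E6_mesh.mirror[OF shift[of 2]]] by simp

lemma arm3: "a 0 * c 2 = d 1 * f 1 + b 2"
proof -
  have "(b 1 * c 1) * (a 0 * c 2) = (b 1 * c 1) * (d 1 * f 1 + b 2)"
    using arm2 mesh_c[of 1, simplified] mesh_b[of 1, simplified] by algebra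
  thus ?thesis by simp
qed

lemma arm3': "a 2 * c 0 = d 0 * f 0 + b (- 1)"
  using E6_mesh.arm3[OF E6_mesh.mirror[OF shift[of 2]]] by simp

text \<open>The arm relation of \<open>a\<close> and the mirrored one of \<open>g\<close>, namely
  \<open>g 4 * c 2 = b 2 * d 2 + f 1\<close>, meet at the branch entry \<open>c 2\<close>.\<close>

lemma hammock: "a 0 * d 2 = e 2 * f 1 + g 4"
proof -
  have "c 2 * (a 0 * d 2) = c 2 * (e 2 * f 1 + g 4)"
    using arm3 mesh_d[of 1, simplified]
      E6_mesh.arm3'[OF E6_mesh.shift[OF E6_mesh.swap_eg[OF E6_mesh.swap_ae[OF swap_eg]], of 2], simplified]
    by algebra
  thus ?thesis by simp
qed

lemma hammock': "a 4 * d 1 = e 2 * f 2 + g 0"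
  using E6_mesh.hammock[OF E6_mesh.mirror[OF shift[of 4]]] by simp

lemma rotate: "E6_mesh g f c b a d e"
  by (rule E6_mesh.swap_ae[OF swap_eg])

lemma J_forms:
  "a 0 * (a (- 1) * e 2 - f 0) = g (- 2) + e 2"
  "a 0 * (a 1 * g (- 2) - d (- 1)) = g (- 2) + e 2"
proof -
  show "a 0 * (a (- 1) * e 2 - f 0) = g (- 2) + e 2"
    using E6_mesh.hammock'[OF E6_mesh.shift[OF swap_ae, of "- 2"], simplified] mesh_a[of "- 1", simplified]
    by algebra
  show "a 0 * (a 1 * g (- 2) - d (- 1)) = g (- 2) + e 2"
    using E6_mesh.hammock[OF E6_mesh.shift[OF rotate, of "- 2"], simplified] mesh_a[of 0, simplified]
    by algebra
qed

text \<open>The two forms have the same right side, so their common factor cancels. The new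
  expression is the old one for cyclically rotated arms, one step earlier.\<close>

lemma J_rotate: "a 0 * e 3 - f 1 = g (- 1) * a 2 - d 0"
proof -
  have "a 0 * (a (- 1) * e 2 - f 0) = a 0 * (g (- 2) * a 1 - d (- 1))" if "E6_mesh a b c d e f g"
    for a b c d e f g :: "int \<Rightarrow> 'a"
    using E6_mesh.J_forms[OF that] by (simp add: mult.commute[of "g _"])
  from this[OF shift[of 1]] show ?thesis by simp
qed

text \<open>Three rotations restore the arms, and each costs one step of time.\<close>

lemma J_period: "a 0 * e 3 - f 1 = a (- 3) * e 0 - f (- 2)"
  using J_rotate E6_mesh.J_rotate[OF E6_mesh.shift[OF rotate, of "- 1"]]
    E6_mesh.J_rotate[OF E6_mesh.shift[OF E6_mesh.rotate[OF rotate], of "- 2"]]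
  by simp

lemma J_eq: "(f 1 + e 3 * g 4) / d 2 = a 0 * e 3 - f 1"
proof -
  have "(a 0 * e 3 - f 1) * d 2 = f 1 + e 3 * g 4"
    using hammock mesh_e[of 2, simplified] by algebra
  thus ?thesis by (simp add: divide_eq_eq)
qed

lemma J_ratio_period: "(f 4 + e 6 * g 7) / d 5 = (f 1 + e 3 * g 4) / d 2"
  using E6_mesh.J_period[OF shift[of 3]] J_eq E6_mesh.J_eq[OF shift[of 3]] by simp

text \<open>This makes \<open>K\<close> a difference of products. Rotation identities rewrite
  \<open>e 0 * a 3\<close> and \<open>e 0 * a (- 3)\<close> by entries nearer to index 0; hammock
  and arm relations resolve the products that remain.\<close>

lemma K_key: "b 0 * a (- 3) = a 0 * e (- 1) * g (- 1) + a 3"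
proof -
  have "e 0 * a 3 - f 1 = g (- 1) * e 2 - b 0"
    by (rule E6_mesh.J_rotate[OF swap_ae])
  moreover have "e (- 2) * g 1 - b (- 1) = a (- 3) * e 0 - f (- 2)"
    using E6_mesh.J_rotate[OF E6_mesh.shift[OF E6_mesh.rotate[OF rotate], of "- 2"]] by simp
  moreover have "e (- 2) * b 0 = a 0 * f (- 1) + g 2"
    using E6_mesh.hammock[OF E6_mesh.shift[OF swap_ae, of "- 2"]] by simp
  moreover have "g (- 2) * b 0 = a 0 * d (- 1) + e 2"
    using E6_mesh.hammock[OF E6_mesh.shift[OF rotate, of "- 2"]] by simp
  moreover have "g 1 * f (- 1) = g (- 1) + c 0"
    using E6_mesh.arm2'[OF E6_mesh.shift[OF rotate, of "- 1"]] by simp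
  moreover note mesh_g[of 1, simplified] mesh_e[of "- 1", simplified] mesh_g[of "- 2", simplified]
    mesh_b[of "- 1", simplified]
  ultimately have "e 0 * (b 0 * a (- 3)) = e 0 * (a 0 * e (- 1) * g (- 1) + a 3)"
    by algebra
  thus ?thesis by simp
qed

text \<open>The fraction is its own mirror image, so the mirror of one form is another. The second
  form is the first read two steps later, whence the period 2.\<close>

lemma K_forms:
  "(a (- 3) + a 3) / a 0 = a 1 * a (- 3) - e (- 1) * g (- 1)"
  "(a (- 3) + a 3) / a 0 = a (- 1) * a 3 - e 1 * g 1"
proof -
  have *: "(a (- 3) + a 3) / a 0 = a 1 * a (- 3) - e (- 1) * g (- 1)" if "E6_mesh a b c d e f g"
    for a b c d e f g :: "int \<Rightarrow> 'a"
  proof -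
    interpret E6_mesh a b c d e f g by fact
    have "a (- 3) + a 3 = (a 1 * a (- 3) - e (- 1) * g (- 1)) * a 0"
      using K_key mesh_a[of 0, simplified] by algebra
    thus ?thesis by (simp add: divide_eq_eq)
  qed
  show "(a (- 3) + a 3) / a 0 = a 1 * a (- 3) - e (- 1) * g (- 1)"
    by (rule *) unfold_locales
  show "(a (- 3) + a 3) / a 0 = a (- 1) * a 3 - e 1 * g 1"
    using *[OF mirror] by (simp add: add.commute)
qed

lemma K_ratio_period: "(a (- 1) + a 5) / a 2 = (a (- 3) + a 3) / a 0"
  using K_forms(2) E6_mesh.K_forms(1)[OF shift[of 2]] by (simp add: mult.commute)

end

lemma E6_frieze_mesh:
  assumes "E6_frieze a b c d e f g"
  shows "E6_mesh a b c d e f g"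
  using E6_frieze_positive[OF assms] assms unfolding E6_frieze_def
  by unfold_locales (auto simp: mult.commute positive_nonzero)

lemma E6_frieze_periods:
  assumes "E6_frieze a b c d e f g"
  shows "has_period (\<lambda>n. (f (n + 1) + e (n + 3) * g (n + 4)) / d (n + 2)) 3"
    and "has_period (\<lambda>n. (f (n - 2) + e (n - 3) * g (n - 4)) / d (n - 3)) 3"
    and "has_period (\<lambda>n. (a (n - 3) + a (n + 3)) / a n) 2"
proof -
  interpret E6_mesh a b c d e f g
    using assms by (rule E6_frieze_mesh)
  have "(f (n + 3 + 1) + e (n + 3 + 3) * g (n + 3 + 4)) / d (n + 3 + 2) =
        (f (n + 1) + e (n + 3) * g (n + 4)) / d (n + 2)" for n
    using E6_mesh.J_ratio_period[OF shift[of n]] by (simp add: algebra_simps)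
  thus "has_period (\<lambda>n. (f (n + 1) + e (n + 3) * g (n + 4)) / d (n + 2)) 3"
    by (simp add: has_period_def)
  \<comment> \<open>This quantity is the first one read in the mirrored frieze.\<close>
  have "(f (n + 3 - 2) + e (n + 3 - 3) * g (n + 3 - 4)) / d (n + 3 - 3) =
        (f (n - 2) + e (n - 3) * g (n - 4)) / d (n - 3)" for n
    using E6_mesh.J_ratio_period[OF E6_mesh.mirror[OF shift[of "n + 3"]]] by (simp add: algebra_simps)
  thus "has_period (\<lambda>n. (f (n - 2) + e (n - 3) * g (n - 4)) / d (n - 3)) 3"
    by (simp add: has_period_def)
  have "(a (n + 2 - 3) + a (n + 2 + 3)) / a (n + 2) = (a (n - 3) + a (n + 3)) / a n" for n
    using E6_mesh.K_ratio_period[OF shift[of n]] by (simp add: algebra_simps)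
  thus "has_period (\<lambda>n. (a (n - 3) + a (n + 3)) / a n) 2"
    by (simp add: has_period_def)
qed

section \<open>Type E7\<close>

locale E7_mesh =
  fixes a b c d e f g h :: "int \<Rightarrow> 'a::field"
  assumes nonzero [simp]: "a n \<noteq> 0" "b n \<noteq> 0" "c n \<noteq> 0" "d n \<noteq> 0" "e n \<noteq> 0" "f n \<noteq> 0" "g n \<noteq> 0" "h n \<noteq> 0"
    and mesh_a: "a n * a (n + 1) = 1 + b n"
    and mesh_b: "b n * b (n + 1) = 1 + a (n + 1) * c (n + 1)"
    and mesh_c: "c n * c (n + 1) = 1 + b n * d n"
    and mesh_d: "d n * d (n + 1) = 1 + c (n + 1) * e (n + 1) * f (n + 1)"
    and mesh_e: "e n * e (n + 1) = 1 + d n"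
    and mesh_f: "f n * f (n + 1) = 1 + d n * g n"
    and mesh_g: "g n * g (n + 1) = 1 + f (n + 1) * h (n + 1)"
    and mesh_h: "h n * h (n + 1) = 1 + g n"
begin

lemmas mesh = mesh_a mesh_b mesh_c mesh_d mesh_e mesh_f mesh_g mesh_h

lemma shift: "E7_mesh (\<lambda>n. a (n + k)) (\<lambda>n. b (n + k)) (\<lambda>n. c (n + k)) (\<lambda>n. d (n + k)) (\<lambda>n. e (n + k)) (\<lambda>n. f (n + k)) (\<lambda>n. g (n + k)) (\<lambda>n. h (n + k))"
proof -
  have "n + 1 + k = n + k + 1" for n by simp
  thus ?thesis by unfold_locales (simp_all only: nonzero mesh not_False_eq_True)
qed

lemma mesh_rev:
  "a n * a (n - 1) = 1 + b (n - 1)"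
  "b n * b (n - 1) = 1 + a n * c n"
  "c n * c (n - 1) = 1 + b (n - 1) * d (n - 1)"
  "d n * d (n - 1) = 1 + c n * e n * f n"
  "e n * e (n - 1) = 1 + d (n - 1)"
  "f n * f (n - 1) = 1 + d (n - 1) * g (n - 1)"
  "g n * g (n - 1) = 1 + f n * h n"
  "h n * h (n - 1) = 1 + g (n - 1)"
  using mesh[of "n - 1"] by (simp_all add: mult_ac)

lemma mirror: "E7_mesh (\<lambda>n. a (- n)) (\<lambda>n. b (- n - 1)) (\<lambda>n. c (- n)) (\<lambda>n. d (- n - 1)) (\<lambda>n. e (- n)) (\<lambda>n. f (- n)) (\<lambda>n. g (- n - 1)) (\<lambda>n. h (- n))"
proof -
  have "- (n + 1) = - n - 1" for n :: int by simp
  thus ?thesis by unfold_locales (simp_all only: nonzero mesh_rev not_False_eq_True)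
qed

lemma swap: "E7_mesh h g f d e c b a"
  by unfold_locales (simp_all only: nonzero mesh mult_ac not_False_eq_True)

lemma arm2: "a 0 * b 1 = c 1 + a 2"
proof -
  have "a 1 * (a 0 * b 1) = a 1 * (c 1 + a 2)"
    using mesh_a[of 0, simplified] mesh_b[of 0, simplified] mesh_a[of 1, simplified] by algebra
  thus ?thesis by simp
qed

lemma arm2': "a 2 * b 0 = c 1 + a 0"
  using E7_mesh.arm2[OF E7_mesh.mirror[OF shift[of 2]]] by simp

lemma arm3: "a 0 * c 2 = d 1 + b 2"
proof -
  have "(b 1 * c 1) * (a 0 * c 2) = (b 1 * c 1) * (d 1 + b 2)"
    using arm2 mesh_c[of 1, simplified] mesh_b[of 1, simplified] by algebra
  thus ?thesis by simp
qed

lemma arm3': "a 2 * c 0 = d 0 + b (- 1)"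
  using E7_mesh.arm3[OF E7_mesh.mirror[OF shift[of 2]]] by simp

lemma arm4: "a 0 * d 2 = e 2 * f 2 + c 3"
proof -
  have "c 2 * (a 0 * d 2) = c 2 * (e 2 * f 2 + c 3)"
    using arm3 mesh_d[of 1, simplified] mesh_c[of 2, simplified] by algebra
  thus ?thesis by simp
qed

lemma arm4': "a 3 * d 0 = e 1 * f 1 + c 0"
  using E7_mesh.arm4[OF E7_mesh.mirror[OF shift[of 3]]] by simp

text \<open>At \<open>d 2\<close> the relation that extends the arm of \<open>a\<close> past the
  branch meets the mirrored one for the arm of \<open>h\<close>.\<close>

lemma hammock: "a 0 * e 3 = f 2 + h 5"
proof -
  have "d 2 * (a 0 * e 3) = d 2 * (f 2 + h 5)"
    using arm4 E7_mesh.arm4'[OF E7_mesh.shift[OF swap, of 2], simplified] mesh_e[of 2, simplified]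
    by algebra
  thus ?thesis by simp
qed

lemma hammock': "a 5 * e 2 = f 3 + h 0"
  using E7_mesh.hammock[OF E7_mesh.mirror[OF shift[of 5]]] by simp

text \<open>The right side is its own mirror image, so reflecting one form gives the other.\<close>

lemma J_forms:
  "e 0 * (a (- 3) * h 1 - e (- 1)) = g (- 2) + g 1"
  "e 0 * (a 3 * h (- 1) - e 1) = g (- 2) + g 1"
proof -
  have *: "e 0 * (a (- 3) * h 1 - e (- 1)) = g (- 2) + g 1" if "E7_mesh a b c d e f g h"
    for a b c d e f g h :: "int \<Rightarrow> 'a"
  proof -
    interpret E7_mesh a b c d e f g h by fact
    show ?thesis
      using E7_mesh.hammock[OF shift, of "- 3", simplified] mesh_h[of 1, simplified]
        E7_mesh.arm3'[OF E7_mesh.shift[OF swap, of "- 1"], simplified] mesh_e[of "- 1", simplified]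
      by algebra
  qed
  show "e 0 * (a (- 3) * h 1 - e (- 1)) = g (- 2) + g 1"
    by (rule *) unfold_locales
  show "e 0 * (a 3 * h (- 1) - e 1) = g (- 2) + g 1"
    using *[OF mirror] by (simp add: add.commute)
qed

lemma J_mirror: "a (- 3) * h 1 - e (- 1) = a 3 * h (- 1) - e 1"
  using J_forms by (metis mult_left_cancel nonzero(5))

text \<open>The mirrored form is the original one with the long arms exchanged, two steps later.
  Doing this twice restores the arms and moves time by 4.\<close>

lemma J_period: "a (- 3) * h 1 - e (- 1) = a 1 * h 5 - e 3"
  using J_mirror E7_mesh.J_mirror[OF E7_mesh.shift[OF swap, of 2]] by (simp add: mult.commute)

text \<open>Here the periodic quantity becomes the coefficient of a linear relation between
  \<open>a\<close> and \<open>h\<close>, which serves to reach far indices.\<close>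

lemma J_end: "h 0 * (a (- 3) * h 1 - e (- 1)) = a (- 3) + a 3"
proof -
  have "e 0 * (h 0 * (a (- 3) * h 1 - e (- 1))) = e 0 * (a (- 3) + a 3)"
    using E7_mesh.hammock[OF shift, of "- 3", simplified]
      E7_mesh.hammock'[OF shift, of "- 2", simplified] mesh_e[of "- 1", simplified]
      mesh_h[of 0, simplified] E7_mesh.arm2'[OF swap]
      E7_mesh.arm3'[OF E7_mesh.shift[OF swap, of "- 1"], simplified]
      E7_mesh.arm2'[OF E7_mesh.shift[OF swap, of "- 2"], simplified]
    by algebra
  thus ?thesis by simp
qed

lemma J_eq: "(e (- 1) + a 3 * h 1) / g 0 = a (- 3) * h 1 - e (- 1)"
proof -
  have "e (- 1) + a 3 * h 1 = (a (- 3) * h 1 - e (- 1)) * g 0"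
    using J_end mesh_h[of 0, simplified] by algebra
  thus ?thesis by (simp add: divide_eq_eq)
qed

lemma a_far: "a 4 = g 1 * a (- 2) - h 1 * e 0"
  using E7_mesh.J_end[OF shift, of 1, simplified] mesh_h[of 1, simplified] by algebra

lemma a_far': "a (- 4) = g (- 2) * a 2 - h (- 1) * e 0"
  using E7_mesh.a_far[OF mirror] by simp

text \<open>Arm relations express each end entry times \<open>d 0\<close> by entries near the
  branch. The difference of the two products is then
  \<open>(e 0 * e 1 - 1) * (f 0 * f 1 - c 0 * c 1)\<close>, which is
  \<open>d 0 * d 0 * (g 0 - b 0)\<close>.\<close>

lemma K_swap: "a (- 2) * a 3 - g 0 = h (- 2) * h 3 - b 0"
proof -
  have "(d 0 * d 0) * (a (- 2) * a 3 - g 0) = (d 0 * d 0) * (h (- 2) * h 3 - b 0)"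
    using E7_mesh.arm4[OF shift, of "- 2", simplified] arm4'
      E7_mesh.arm4[OF E7_mesh.shift[OF swap], of "- 2", simplified] E7_mesh.arm4'[OF swap]
      mesh_e[of 0, simplified] mesh_f[of 0, simplified] mesh_c[of 0, simplified]
    by algebra
  thus ?thesis by simp
qed

lemma K_key: "b 0 * a (- 4) = a 0 * g (- 2) + a 4"
  using a_far a_far' arm2' E7_mesh.hammock'[OF E7_mesh.shift[OF swap, of "- 2"], simplified]
    J_forms(2) E7_mesh.hammock[OF shift, of "- 2", simplified] mesh_h[of "- 2", simplified]
    E7_mesh.arm2[OF E7_mesh.shift[OF swap, of "- 1"], simplified] K_swap
  by algebra

text \<open>The second bracket is both the mirror image of the first and its translate by 3, which
  yields the period.\<close>

lemma K_forms:
  "a (- 4) + a 4 = a 0 * (a 1 * a (- 4) - g (- 2))"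
  "a (- 4) + a 4 = a 0 * (a (- 1) * a 4 - g 1)"
proof -
  have *: "a (- 4) + a 4 = a 0 * (a 1 * a (- 4) - g (- 2))" if "E7_mesh a b c d e f g h"
    for a b c d e f g h :: "int \<Rightarrow> 'a"
    using E7_mesh.K_key[OF that] E7_mesh.mesh_a[OF that, of 0, simplified] by algebra
  show "a (- 4) + a 4 = a 0 * (a 1 * a (- 4) - g (- 2))"
    by (rule *) unfold_locales
  show "a (- 4) + a 4 = a 0 * (a (- 1) * a 4 - g 1)"
    using *[OF mirror] by (simp add: add.commute)
qed

text \<open>Eliminating the coefficients \<open>j\<close> and \<open>k\<close> of linear relations
  turns both sides into \<open>a (- 7) * h 0 - a (- 3) * h (- 4)\<close>.\<close>

lemma L_mirror: "a (- 3) * h 4 - a 1 * h 0 = a 3 * h (- 4) - a (- 1) * h 0"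
proof -
  define j k where "j = a (- 3) * h 1 - e (- 1)" and "k = a 1 * a (- 4) - g (- 2)"
  have "h 0 * j = a (- 3) + a 3"
    unfolding j_def by (rule J_end)
  \<comment> \<open>The period 4 of \<open>j\<close> enters here.\<close>
  moreover have "h (- 4) * j = a (- 7) + a (- 1)"
    using E7_mesh.J_end[OF shift, of "- 4"] E7_mesh.J_period[OF shift, of "- 4"]
    by (simp add: j_def)
  moreover have "a (- 3) * k = a (- 7) + a 1"
    using E7_mesh.K_forms(2)[OF shift, of "- 3"] by (simp add: k_def mult.commute)
  \<comment> \<open>\<open>k\<close> is the same coefficient for both long arms.\<close>
  moreover have "h 0 * k = h (- 4) + h 4"
  proof -
    have "k = a (- 1) * a 4 - g 1"
      using K_forms by (metis k_def mult_left_cancel nonzero(1))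
    also have "\<dots> = h (- 1) * h 4 - b 1"
      using E7_mesh.K_swap[OF shift, of 1] by simp
    finally show ?thesis
      using E7_mesh.K_forms(2)[OF swap] by simp
  qed
  ultimately show ?thesis by algebra
qed

text \<open>The right side of the first form is that of the second two steps later; cancelling
  \<open>e 1\<close> will give the period 2.\<close>

lemma L_forms:
  "e 1 * (a (- 3) * h 4 - a 1 * h 0) = a (- 3) * a (- 1) + a 3 * a 5"
  "e (- 1) * (a (- 3) * h 4 - a 1 * h 0) = a (- 5) * a (- 3) + a 1 * a 3"
proof -
  have *: "e 1 * (a (- 3) * h 4 - a 1 * h 0) = a (- 3) * a (- 1) + a 3 * a 5"
    if "E7_mesh a b c d e f g h" for a b c d e f g h :: "int \<Rightarrow> 'a"
  proof -
    interpret E7_mesh a b c d e f g h by fact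
    define j where "j = a 3 * h (- 1) - e 1"
    have "a 2 * j = h (- 1) + h 5"
      using E7_mesh.J_end[OF E7_mesh.shift[OF swap], of 2] by (simp add: j_def mult.commute)
    moreover have "j = a 1 * h 5 - e 3"
      using J_mirror J_period by (simp add: j_def)
    moreover note j_def E7_mesh.arm2[OF shift, of 1, simplified] mesh_a[of 2, simplified]
    \<comment> \<open>Here \<open>c 2 = a 1 * a 2 * a 3 - a 1 - a 3\<close>. Expanding
      \<open>a 1 * j\<close> and \<open>a 3 * j\<close> by different forms of \<open>j\<close>
      cancels both products in \<open>a 1 * a 3 * (h (- 1) + h 5)\<close>.\<close>
    ultimately have "j * c 2 = a 1 * e 1 + a 3 * e 3"
      by algebra
    moreover have "h 0 * j = a (- 3) + a 3"
      using J_end J_mirror by (simp add: j_def)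
    ultimately show ?thesis
      using E7_mesh.hammock'[OF E7_mesh.shift[OF swap, of "- 1"], simplified] E7_mesh.hammock[OF swap]
      by algebra
  qed
  show "e 1 * (a (- 3) * h 4 - a 1 * h 0) = a (- 3) * a (- 1) + a 3 * a 5"
    by (rule *) unfold_locales
  show "e (- 1) * (a (- 3) * h 4 - a 1 * h 0) = a (- 5) * a (- 3) + a 1 * a 3"
    using *[OF mirror] unfolding L_mirror by (simp add: algebra_simps)
qed

lemma L_period: "a (- 1) * h 6 - a 3 * h 2 = a (- 3) * h 4 - a 1 * h 0"
proof -
  have "e 1 * (a (- 1) * h 6 - a 3 * h 2) = e 1 * (a (- 3) * h 4 - a 1 * h 0)"
    using E7_mesh.L_forms(2)[OF shift, of 2] L_forms(1) by (simp add: add.commute mult.commute)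
  thus ?thesis by simp
qed

end

lemma E7_frieze_mesh:
  assumes "E7_frieze a b c d e f g h"
  shows "E7_mesh a b c d e f g h"
  using E7_frieze_positive[OF assms] assms unfolding E7_frieze_def
  by unfold_locales (auto simp: mult.commute positive_nonzero)

lemma E7_frieze_periods:
  assumes "E7_frieze a b c d e f g h"
  shows "has_period (\<lambda>n. (e (n + 2) + a (n + 6) * h (n + 4)) / g (n + 3)) 4"
    and "has_period (\<lambda>n. (a (n + 8) + a n) / a (n + 4)) 3"
    and "has_period (\<lambda>n. a n * h (n + 7) - a (n + 4) * h (n + 3)) 2"
proof -
  interpret E7_mesh a b c d e f g h
    using assms by (rule E7_frieze_mesh)
  have eq: "(e (n + 2) + a (n + 6) * h (n + 4)) / g (n + 3) = a n * h (n + 4) - e (n + 2)" for n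
    using E7_mesh.J_eq[OF shift, of "n + 3"] by (simp add: algebra_simps)
  have "a (n + 4) * h (n + 8) - e (n + 6) = a n * h (n + 4) - e (n + 2)" for n
    using E7_mesh.J_period[OF shift, of "n + 3"] by (simp add: algebra_simps)
  hence "(e (n + 4 + 2) + a (n + 4 + 6) * h (n + 4 + 4)) / g (n + 4 + 3) =
        (e (n + 2) + a (n + 6) * h (n + 4)) / g (n + 3)" for n
    unfolding eq by (simp add: add.assoc)
  thus "has_period (\<lambda>n. (e (n + 2) + a (n + 6) * h (n + 4)) / g (n + 3)) 4"
    by (simp add: has_period_def)
  have eq: "(a (n + 8) + a n) / a (n + 4) = a n * a (n + 5) - g (n + 2)"
    "(a (n + 8) + a n) / a (n + 4) = a (n + 3) * a (n + 8) - g (n + 5)" for n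
    using E7_mesh.K_forms[OF shift, of "n + 4"]
    by (simp_all add: field_simps)
  have "(a (n + 3 + 8) + a (n + 3)) / a (n + 3 + 4) = (a (n + 8) + a n) / a (n + 4)" for n
    unfolding eq(2)[of n] eq(1)[of "n + 3"] by (simp add: add.assoc)
  thus "has_period (\<lambda>n. (a (n + 8) + a n) / a (n + 4)) 3"
    by (simp add: has_period_def)
  have "a (n + 2) * h (n + 2 + 7) - a (n + 2 + 4) * h (n + 2 + 3) =
        a n * h (n + 7) - a (n + 4) * h (n + 3)" for n
    using E7_mesh.L_period[OF shift, of "n + 3"] by (simp add: algebra_simps)
  thus "has_period (\<lambda>n. a n * h (n + 7) - a (n + 4) * h (n + 3)) 2"
    by (simp add: has_period_def)
qed

section \<open>Type E8\<close>

locale E8_mesh =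
  fixes a b c d e f g h i :: "int \<Rightarrow> 'a::field"
  assumes nonzero [simp]: "a n \<noteq> 0" "b n \<noteq> 0" "c n \<noteq> 0" "d n \<noteq> 0" "e n \<noteq> 0" "f n \<noteq> 0" "g n \<noteq> 0" "h n \<noteq> 0" "i n \<noteq> 0"
    and mesh_a: "a n * a (n + 1) = 1 + b n"
    and mesh_b: "b n * b (n + 1) = 1 + a (n + 1) * c (n + 1)"
    and mesh_c: "c n * c (n + 1) = 1 + b n * d n"
    and mesh_d: "d n * d (n + 1) = 1 + c (n + 1) * e (n + 1)"
    and mesh_e: "e n * e (n + 1) = 1 + d n * f n"
    and mesh_f: "f n * f (n + 1) = 1 + e (n + 1) * g (n + 1) * h (n + 1)"
    and mesh_g: "g n * g (n + 1) = 1 + f n"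
    and mesh_h: "h n * h (n + 1) = 1 + f n * i n"
    and mesh_i: "i n * i (n + 1) = 1 + h (n + 1)"
begin

lemmas mesh = mesh_a mesh_b mesh_c mesh_d mesh_e mesh_f mesh_g mesh_h mesh_i

lemma shift: "E8_mesh (\<lambda>n. a (n + k)) (\<lambda>n. b (n + k)) (\<lambda>n. c (n + k)) (\<lambda>n. d (n + k)) (\<lambda>n. e (n + k)) (\<lambda>n. f (n + k)) (\<lambda>n. g (n + k)) (\<lambda>n. h (n + k)) (\<lambda>n. i (n + k))"
proof -
  have "n + 1 + k = n + k + 1" for n by simp
  thus ?thesis by unfold_locales (simp_all only: nonzero mesh not_False_eq_True)
qed

lemma mesh_rev:
  "a n * a (n - 1) = 1 + b (n - 1)"
  "b n * b (n - 1) = 1 + a n * c n"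
  "c n * c (n - 1) = 1 + b (n - 1) * d (n - 1)"
  "d n * d (n - 1) = 1 + c n * e n"
  "e n * e (n - 1) = 1 + d (n - 1) * f (n - 1)"
  "f n * f (n - 1) = 1 + e n * g n * h n"
  "g n * g (n - 1) = 1 + f (n - 1)"
  "h n * h (n - 1) = 1 + f (n - 1) * i (n - 1)"
  "i n * i (n - 1) = 1 + h n"
  using mesh[of "n - 1"] by (simp_all add: mult_ac)

lemma mirror: "E8_mesh (\<lambda>n. a (- n)) (\<lambda>n. b (- n - 1)) (\<lambda>n. c (- n)) (\<lambda>n. d (- n - 1)) (\<lambda>n. e (- n)) (\<lambda>n. f (- n - 1)) (\<lambda>n. g (- n)) (\<lambda>n. h (- n)) (\<lambda>n. i (- n - 1))"
proof -
  have "- (n + 1) = - n - 1" for n :: int by simp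
  thus ?thesis by unfold_locales (simp_all only: nonzero mesh_rev not_False_eq_True)
qed

lemma arm2: "a 0 * b 1 = c 1 + a 2"
proof -
  have "a 1 * (a 0 * b 1) = a 1 * (c 1 + a 2)"
    using mesh_a[of 0, simplified] mesh_b[of 0, simplified] mesh_a[of 1, simplified] by algebra
  thus ?thesis by simp
qed

lemma arm3: "a 0 * c 2 = d 1 + b 2"
proof -
  have "b 1 * (a 0 * c 2) = b 1 * (d 1 + b 2)"
    using arm2 mesh_c[of 1, simplified] mesh_b[of 1, simplified] by algebra
  thus ?thesis by simp
qed

lemma arm4: "a 0 * d 2 = e 2 + c 3"
proof -
  have "c 2 * (a 0 * d 2) = c 2 * (e 2 + c 3)"
    using arm3 mesh_d[of 1, simplified] mesh_c[of 2, simplified] by algebra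
  thus ?thesis by simp
qed

lemma arm5: "a 0 * e 3 = f 2 + d 3"
proof -
  have "d 2 * (a 0 * e 3) = d 2 * (f 2 + d 3)"
    using arm4 mesh_e[of 2, simplified] mesh_d[of 2, simplified] by algebra
  thus ?thesis by simp
qed

lemma arm6: "a 0 * f 3 = g 3 * h 3 + e 4"
proof -
  have "e 3 * (a 0 * f 3) = e 3 * (g 3 * h 3 + e 4)"
    using arm5 mesh_f[of 2, simplified] mesh_e[of 3, simplified] by algebra
  thus ?thesis by simp
qed

lemma arm2': "a 2 * b 0 = c 1 + a 0"
  using E8_mesh.arm2[OF E8_mesh.mirror[OF shift[of 2]]] by simp

lemma arm5': "a 4 * e 1 = f 1 + d 0"
  using E8_mesh.arm5[OF E8_mesh.mirror[OF shift[of 4]]] by simp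

lemma arm6': "a 4 * f 0 = g 1 * h 1 + e 0"
  using E8_mesh.arm6[OF E8_mesh.mirror[OF shift[of 4]]] by simp

lemma short_arm: "g 0 * f 1 = e 1 * h 1 + g 2"
proof -
  have "g 1 * (g 0 * f 1) = g 1 * (e 1 * h 1 + g 2)"
    using mesh_g[of 0, simplified] mesh_f[of 0, simplified] mesh_g[of 1, simplified] by algebra
  thus ?thesis by simp
qed

lemma short_arm': "g 2 * f 0 = e 1 * h 1 + g 0"
  using E8_mesh.short_arm[OF E8_mesh.mirror[OF shift[of 2]]] by simp

lemma middle_arm2: "i 0 * h 2 = f 1 + i 2"
proof -
  have "i 1 * (i 0 * h 2) = i 1 * (f 1 + i 2)"
    using mesh_i[of 0, simplified] mesh_h[of 1, simplified] mesh_i[of 1, simplified] by algebra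
  thus ?thesis by simp
qed

lemma middle_arm2': "i 2 * h 1 = f 1 + i 0"
  using E8_mesh.middle_arm2[OF E8_mesh.mirror[OF shift[of 3]]] by simp

lemma middle_arm3: "i 0 * f 2 = e 2 * g 2 + h 3"
proof -
  have "h 2 * (i 0 * f 2) = h 2 * (e 2 * g 2 + h 3)"
    using middle_arm2 mesh_f[of 1, simplified] mesh_h[of 2, simplified] by algebra
  thus ?thesis by simp
qed

text \<open>The factor \<open>f 0\<close> brings in the arm relation of \<open>a\<close>, and
  \<open>h 1\<close> that of \<open>i\<close>.\<close>

lemma hammock_gi: "g 0 * i 2 = a (- 3) + e 1"
proof -
  have "(h 1 * f 0) * (g 0 * i 2) = (h 1 * f 0) * (a (- 3) + e 1)"
    using E8_mesh.arm6[OF shift, of "- 3", simplified] middle_arm2' mesh_f[of 0, simplified]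
      mesh_g[of 0, simplified] mesh_h[of 0, simplified]
    by algebra
  thus ?thesis by simp
qed

lemma hammock_gi': "g 0 * i (- 3) = a 3 + e (- 1)"
  using E8_mesh.hammock_gi[OF mirror] by simp

lemma hammock_ag: "a 0 * g 4 = h 3 + i 5"
proof -
  have "g 3 * (a 0 * g 4) = g 3 * (h 3 + i 5)"
    using arm6 mesh_g[of 3, simplified] E8_mesh.hammock_gi[OF shift, of 3, simplified] by algebra
  thus ?thesis by simp
qed

text \<open>The arm of \<open>a\<close> is followed past the branch from both sides in time, through
  \<open>a 0 * f 3\<close> and \<open>a 8 * f 4\<close>.\<close>

lemma hammock_ai: "a 0 * i 4 = a 8 + g 3"
proof -
  have "(f 3 * f 4 * g 4) * (a 0 * i 4) = (f 3 * f 4 * g 4) * (a 8 + g 3)"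
    using arm6 E8_mesh.arm6'[OF shift, of 4, simplified] mesh_g[of 3, simplified]
      mesh_g[of 4, simplified] mesh_f[of 3, simplified] mesh_h[of 4, simplified]
      E8_mesh.middle_arm2'[OF shift, of 2, simplified] E8_mesh.middle_arm3[OF shift, of 2, simplified]
    by algebra
  thus ?thesis by simp
qed

lemma hammock_ai': "a 8 * i 3 = a 0 + g 5"
  using E8_mesh.hammock_ai[OF E8_mesh.mirror[OF shift[of 8]]] by simp

lemma hammock_ah: "a 0 * h 4 = g 3 * i 3 + g 5"
proof -
  have "f 3 * (a 0 * h 4) = f 3 * (g 3 * i 3 + g 5)"
    using arm6 mesh_h[of 3, simplified] E8_mesh.short_arm'[OF shift, of 3, simplified] by algebra
  thus ?thesis by simp
qed

text \<open>Again the right side is its own mirror image.\<close>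

lemma J_forms:
  "g 0 * (a (- 1) * a 6 - i 2) = c (- 2) + c 2"
  "g 0 * (a 1 * a (- 6) - i (- 3)) = c (- 2) + c 2"
proof -
  have *: "g 0 * (a (- 1) * a 6 - i 2) = c (- 2) + c 2" if "E8_mesh a b c d e f g h i"
    for a b c d e f g h i :: "int \<Rightarrow> 'a"
  proof -
    interpret E8_mesh a b c d e f g h i by fact
    show ?thesis
      using E8_mesh.hammock_ai[OF shift, of "- 2", simplified] hammock_gi mesh_g[of 0, simplified]
        E8_mesh.arm2[OF shift, of "- 3", simplified] mesh_a[of "- 2", simplified]
        E8_mesh.arm5[OF shift, of "- 2", simplified] E8_mesh.arm4[OF shift, of "- 1", simplified]
      by algebra
  qed
  show "g 0 * (a (- 1) * a 6 - i 2) = c (- 2) + c 2"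
    by (rule *) unfold_locales
  show "g 0 * (a 1 * a (- 6) - i (- 3)) = c (- 2) + c 2"
    using *[OF mirror] by (simp add: add.commute)
qed

lemma J_mirror: "a (- 1) * a 6 - i 2 = a 1 * a (- 6) - i (- 3)"
  using J_forms by (metis mult_left_cancel nonzero(7))

text \<open>The mirrored form read five steps later is the first form.\<close>

lemma J_period: "a 4 * a 11 - i 7 = a (- 1) * a 6 - i 2"
  using E8_mesh.J_mirror[OF shift, of 5] by (simp add: mult.commute)

text \<open>Times \<open>g 0\<close>, both \<open>a 6 * b (- 1) - a 0 * i 2\<close> and
  \<open>a (- 6)\<close> equal \<open>b 2 + d (- 2)\<close>. The result underlies the linear
  relation between entries of \<open>a\<close> six steps from the centre.\<close>

lemma J_key: "a 6 * b (- 1) = a 0 * i 2 + a (- 6)"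
proof -
  have "g 0 * (a 6 * b (- 1) - a 0 * i 2) = b 2 + d (- 2)"
    using E8_mesh.hammock_ai[OF shift, of "- 2", simplified] hammock_gi mesh_g[of 0, simplified]
      E8_mesh.arm2[OF shift, of "- 2", simplified] E8_mesh.arm3[OF shift, of "- 3", simplified]
      mesh_a[of "- 1", simplified] arm3
      E8_mesh.arm5[OF shift, of "- 2", simplified] E8_mesh.arm4[OF shift, of "- 1", simplified]
    by algebra
  moreover have "g 0 * a (- 6) = b 2 + d (- 2)"
    using E8_mesh.hammock_ai'[OF shift, of "- 6", simplified] hammock_gi' mesh_g[of "- 1", simplified]
      mesh_a[of 2, simplified] E8_mesh.arm5'[OF shift, of "- 2", simplified]
    by algebra
  ultimately have "g 0 * (a 6 * b (- 1)) = g 0 * (a 0 * i 2 + a (- 6))"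
    by algebra
  thus ?thesis by simp
qed

lemma J_end: "a 0 * (a 1 * a (- 6) - i (- 3)) = a (- 6) + a 6"
  using J_key mesh_a[of "- 1", simplified] J_mirror by algebra

lemma J_eq: "(g (- 1) + a 6 * b 1) / c 1 = a (- 1) * a 6 - i 2"
proof -
  have "g (- 1) + a 6 * b 1 = (a (- 1) * a 6 - i 2) * c 1"
    using J_end J_mirror arm2 mesh_a[of 1, simplified]
      E8_mesh.hammock_ai'[OF shift, of "- 6", simplified]
    by algebra
  thus ?thesis by (simp add: divide_eq_eq)
qed

lemma J_i: "i 1 * (a (- 1) * a 6 - i 2) = b (- 2) + i 4"
  using E8_mesh.hammock_ai[OF shift, of "- 2", simplified] mesh_a[of "- 2", simplified]
    E8_mesh.hammock_ag[OF shift, of "- 1", simplified] E8_mesh.hammock_ah[OF shift, of "- 2", simplified]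
    mesh_i[of 1, simplified]
  by algebra

lemma J_i': "i (- 2) * (a 1 * a (- 6) - i (- 3)) = b 1 + i (- 5)"
  using E8_mesh.J_i[OF mirror] by simp

text \<open>The periodic quantity is eliminated between its relations with \<open>a 2\<close> and
  \<open>i 0\<close>; hammock relations resolve the rest, and \<open>g (- 1)\<close>
  cancels.\<close>

lemma hammock_ai_far: "a 8 * i 0 = a (- 6) + c 3"
  using E8_mesh.J_end[OF shift, of 2, simplified] E8_mesh.J_i'[OF shift, of 2, simplified]
    E8_mesh.hammock_ai'[OF shift, of "- 6", simplified]
    E8_mesh.hammock_ai[OF shift, of "- 4", simplified] E8_mesh.arm2[OF shift, of 2, simplified]
  by algebra

text \<open>The linear relation at \<open>a 4\<close>, with its coefficient in mirrored form,
  produces \<open>a 0 * a 4 * a (- 7)\<close>; what is left over is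
  \<open>c (- 1) + a (- 2) = a 0 * b (- 2)\<close>. The two forms are mirror images and translates
  by 3.\<close>

lemma K_forms:
  "a (- 10) + a 10 = a 0 * (a 4 * a (- 7) - b (- 2))"
  "a (- 10) + a 10 = a 0 * (a (- 4) * a 7 - b 1)"
proof -
  have *: "a (- 10) + a 10 = a 0 * (a 4 * a (- 7) - b (- 2))" if "E8_mesh a b c d e f g h i"
    for a b c d e f g h i :: "int \<Rightarrow> 'a"
  proof -
    interpret E8_mesh a b c d e f g h i by fact
    show ?thesis
      using E8_mesh.J_end[OF shift, of 4, simplified] E8_mesh.J_mirror[OF shift, of "- 1", simplified]
        E8_mesh.hammock_ai_far[OF shift, of "- 4", simplified]
        E8_mesh.J_key[OF shift, of "- 4", simplified] E8_mesh.arm2'[OF shift, of "- 2", simplified]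
      by algebra
  qed
  show "a (- 10) + a 10 = a 0 * (a 4 * a (- 7) - b (- 2))"
    by (rule *) unfold_locales
  show "a (- 10) + a 10 = a 0 * (a (- 4) * a 7 - b 1)"
    using *[OF mirror] by (simp add: add.commute)
qed

end

lemma E8_frieze_mesh:
  assumes "E8_frieze a b c d e f g h i"
  shows "E8_mesh a b c d e f g h i"
  using E8_frieze_positive[OF assms] assms unfolding E8_frieze_def
  by unfold_locales (auto simp: mult.commute positive_nonzero)

lemma E8_frieze_periods:
  assumes "E8_frieze a b c d e f g h i"
  shows "has_period (\<lambda>n. (g (n + 2) + a (n + 9) * b (n + 4)) / c (n + 4)) 5"
    and "has_period (\<lambda>n. (a (n + 20) + a n) / a (n + 10)) 3"
proof -
  interpret E8_mesh a b c d e f g h i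
    using assms by (rule E8_frieze_mesh)
  have eq: "(g (n + 2) + a (n + 9) * b (n + 4)) / c (n + 4) = a (n + 2) * a (n + 9) - i (n + 5)" for n
    using E8_mesh.J_eq[OF shift, of "n + 3"] by (simp add: algebra_simps)
  have "a (n + 7) * a (n + 14) - i (n + 10) = a (n + 2) * a (n + 9) - i (n + 5)" for n
    using E8_mesh.J_period[OF shift, of "n + 3"] by (simp add: algebra_simps)
  hence "(g (n + 5 + 2) + a (n + 5 + 9) * b (n + 5 + 4)) / c (n + 5 + 4) =
        (g (n + 2) + a (n + 9) * b (n + 4)) / c (n + 4)" for n
    unfolding eq by (simp add: add.assoc)
  thus "has_period (\<lambda>n. (g (n + 2) + a (n + 9) * b (n + 4)) / c (n + 4)) 5"
    by (simp add: has_period_def)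
  have eq: "(a (n + 20) + a n) / a (n + 10) = a (n + 3) * a (n + 14) - b (n + 8)"
    "(a (n + 20) + a n) / a (n + 10) = a (n + 6) * a (n + 17) - b (n + 11)" for n
    using E8_mesh.K_forms[OF shift, of "n + 10"]
    by (simp_all add: field_simps)
  have "(a (n + 3 + 20) + a (n + 3)) / a (n + 3 + 10) = (a (n + 20) + a n) / a (n + 10)" for n
    unfolding eq(2)[of n] eq(1)[of "n + 3"] by (simp add: add.assoc)
  thus "has_period (\<lambda>n. (a (n + 20) + a n) / a (n + 10)) 3"
    by (simp add: has_period_def)
qed

theorem theorem1p2:
  shows
    "(\<forall>p q x. p \<ge> 1 \<and> q \<ge> 1 \<and> A_frieze p q x \<longrightarrow>
        has_period (\<lambda>n. (x (n + 2 * int q) + x n) / x (n + int q)) p \<and>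
        has_period (\<lambda>n. (x (n + 2 * int p) + x n) / x (n + int p)) q) \<and>
     (\<forall>N X. N \<ge> 4 \<and> D_frieze N X \<longrightarrow>
        has_period (\<lambda>n. (X 1 (n + 1) + X 1 (n - 1)) / X 2 n) (N - 2) \<and>
        has_period (\<lambda>n. X 1 n / X 2 n) 2 \<and>
        has_period (\<lambda>n. X N n / X (N + 1) n) 2) \<and>
     (\<forall>a b c d e f g. E6_frieze a b c d e f g \<longrightarrow>
        has_period (\<lambda>n. (f (n + 1) + e (n + 3) * g (n + 4)) / d (n + 2)) 3 \<and>
        has_period (\<lambda>n. (f (n - 2) + e (n - 3) * g (n - 4)) / d (n - 3)) 3 \<and>
        has_period (\<lambda>n. (a (n - 3) + a (n + 3)) / a n) 2) \<and>
     (\<forall>a b c d e f g h. E7_frieze a b c d e f g h \<longrightarrow>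
        has_period (\<lambda>n. (e (n + 2) + a (n + 6) * h (n + 4)) / g (n + 3)) 4 \<and>
        has_period (\<lambda>n. (a (n + 8) + a n) / a (n + 4)) 3 \<and>
        has_period (\<lambda>n. a n * h (n + 7) - a (n + 4) * h (n + 3)) 2) \<and>
     (\<forall>a b c d e f g h i. E8_frieze a b c d e f g h i \<longrightarrow>
        has_period (\<lambda>n. (g (n + 2) + a (n + 9) * b (n + 4)) / c (n + 4)) 5 \<and>
        has_period (\<lambda>n. (a (n + 20) + a n) / a (n + 10)) 3)"
  using A_frieze_periods D_frieze_periods E6_frieze_periods E7_frieze_periods E8_frieze_periods
  by (intro conjI allI impI) blast+

end
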